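(* Let $\mathfrak q$ be a finite-dimensional algebraic Lie algebra over $\Bbbk$. For any $\vartheta\in\mathrm{Aut}(\mathfrak q)$ of finite order $m\ge2$, the Poisson brackets $\{\,,\,\}_0$ and $\{\,,\,\}_\infty$ on $\mathcal S(\mathfrak q)$ are compatible, and the corresponding pencil $\{a\{\,,\,\}_0+b\{\,,\,\}_\infty\mid a,b\in\Bbbk\}$ contains the initial Lie–Poisson bracket of $\mathfrak q$.
   Context: The ground field $\Bbbk$ is algebraically closed of characteristic $0$. A Lie algebra is algebraic if it is the Lie algebra of a connected affine algebraic group. Fix a primitive $m$-th root of unity $\zeta$; for $j\in\{0,\dots,m-1\}$ let $\mathfrak q_j=\{x\in\mathfrak q\mid\vartheta(x)=\zeta^jx\}$. For $x\in\mathfrak q_i$, $y\in\mathfrak q_j$ with $i,j\in\{0,\dots,m-1\}$, set $\{x,y\}_0=[x,y]$ if $i+j<m$ and $\{x,y\}_0=0$ if $i+j\ge m$; set $\{x,y\}_\infty=0$ if $i+j<m$ and $\{x,y\}_\infty=[x,y]$ if $i+j\ge m$. Both are extended bilinearly to $\mathfrak q$ and by the Leibniz rule to the symmetric algebra $\mathcal S(\mathfrak q)$. The Lie–Poisson bracket of $\mathfrak q$ on $\mathcal S(\mathfrak q)$ is the extension of $\{x,y\}=[x,y]$, $x,y\in\mathfrak q$, by the Leibniz rule. Two Poisson brackets are compatible if every linear combination of them with coefficients in $\Bbbk$ is again a Poisson bracket. *)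

theory Defs
  imports
    "HOL-Library.FuncSet"
    "HOL-Library.Poly_Mapping"
    "HOL-Computational_Algebra.Polynomial"
    "HOL-Algebra.Module"
    "HOL-Algebra.QuotRing"
begin

section \<open>Lie algebras\<close>

definition bilinear_map :: "('k::field \<Rightarrow> 'q::ab_group_add \<Rightarrow> 'q) \<Rightarrow> ('q \<Rightarrow> 'q \<Rightarrow> 'q) \<Rightarrow> bool" where
  "bilinear_map scale \<beta> \<longleftrightarrow>
     (\<forall>x. Vector_Spaces.linear scale scale (\<beta> x)) \<and>
     (\<forall>y. Vector_Spaces.linear scale scale (\<lambda>x. \<beta> x y))"

locale lie_algebra = vector_space scale
  for scale :: "'k::field \<Rightarrow> 'q::ab_group_add \<Rightarrow> 'q" +
  fixes br :: "'q \<Rightarrow> 'q \<Rightarrow> 'q"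
  assumes bilinear: "bilinear_map scale br"
    and alternating: "br x x = 0"
    and jacobi: "br x (br y z) + br y (br z x) + br z (br x y) = 0"

definition finite_dimensional :: "('k::field \<Rightarrow> 'q::ab_group_add \<Rightarrow> 'q) \<Rightarrow> bool" where
  "finite_dimensional scale \<longleftrightarrow> (\<exists>B. finite B \<and> module.span scale B = UNIV)"

definition lie_automorphism ::
  "('k::field \<Rightarrow> 'q::ab_group_add \<Rightarrow> 'q) \<Rightarrow> ('q \<Rightarrow> 'q \<Rightarrow> 'q) \<Rightarrow> ('q \<Rightarrow> 'q) \<Rightarrow> bool" where
  "lie_automorphism scale br \<theta> \<longleftrightarrow>
     Vector_Spaces.linear scale scale \<theta> \<and> bij \<theta> \<and> (\<forall>x y. \<theta> (br x y) = br (\<theta> x) (\<theta> y))"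

definition has_order :: "('q \<Rightarrow> 'q) \<Rightarrow> nat \<Rightarrow> bool" where
  "has_order \<theta> m \<longleftrightarrow> 0 < m \<and> \<theta> ^^ m = id \<and> (\<forall>k. 0 < k \<and> k < m \<longrightarrow> \<theta> ^^ k \<noteq> id)"

definition primitive_root_of_unity :: "nat \<Rightarrow> 'k::field \<Rightarrow> bool" where
  "primitive_root_of_unity m \<zeta> \<longleftrightarrow> 0 < m \<and> \<zeta> ^ m = 1 \<and> (\<forall>k. 0 < k \<and> k < m \<longrightarrow> \<zeta> ^ k \<noteq> 1)"


section \<open>Connected affine algebraic groups and algebraic Lie algebras\<close>

text \<open>
  An affine variety over an algebraically closed field is given by its set \<open>X\<close> of points
  and its algebra \<open>A\<close> of regular functions.  Regular functions are extensional
  on \<open>X\<close>, hence the restricted abstractions.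
\<close>

definition function_algebra :: "'g set \<Rightarrow> ('g \<Rightarrow> 'k::field) set \<Rightarrow> bool" where
  "function_algebra X A \<longleftrightarrow>
     A \<subseteq> X \<rightarrow>\<^sub>E UNIV \<and>
     (\<forall>c. (\<lambda>x\<in>X. c) \<in> A) \<and>
     (\<forall>f\<in>A. \<forall>g\<in>A. (\<lambda>x\<in>X. f x + g x) \<in> A \<and> (\<lambda>x\<in>X. f x * g x) \<in> A)"

definition finitely_generated :: "'g set \<Rightarrow> ('g \<Rightarrow> 'k::field) set \<Rightarrow> bool" where
  "finitely_generated X A \<longleftrightarrow>
     (\<exists>F. finite F \<and> F \<subseteq> A \<and> (\<forall>B. function_algebra X B \<and> F \<subseteq> B \<longrightarrow> A \<subseteq> B))"

text \<open>
  Unital algebra homomorphisms from \<open>A\<close> to the ground field; preservation of constants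
  together with multiplicativity gives linearity.
\<close>

definition algebra_character :: "'g set \<Rightarrow> ('g \<Rightarrow> 'k::field) set \<Rightarrow> (('g \<Rightarrow> 'k) \<Rightarrow> 'k) \<Rightarrow> bool" where
  "algebra_character X A \<phi> \<longleftrightarrow>
     (\<forall>c. \<phi> (\<lambda>x\<in>X. c) = c) \<and>
     (\<forall>f\<in>A. \<forall>g\<in>A. \<phi> (\<lambda>x\<in>X. f x + g x) = \<phi> f + \<phi> g \<and> \<phi> (\<lambda>x\<in>X. f x * g x) = \<phi> f * \<phi> g)"

definition affine_variety :: "'g set \<Rightarrow> ('g \<Rightarrow> 'k::field) set \<Rightarrow> bool" where
  "affine_variety X A \<longleftrightarrow>
     function_algebra X A \<and> finitely_generated X A \<and>
     (\<forall>\<phi>. algebra_character X A \<phi> \<longrightarrow> (\<exists>!x. x \<in> X \<and> (\<forall>f\<in>A. \<phi> f = f x)))"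

definition zero_locus :: "'g set \<Rightarrow> ('g \<Rightarrow> 'k::field) set \<Rightarrow> 'g set" where
  "zero_locus X F = {x \<in> X. \<forall>f\<in>F. f x = 0}"

definition zariski_connected :: "'g set \<Rightarrow> ('g \<Rightarrow> 'k::field) set \<Rightarrow> bool" where
  "zariski_connected X A \<longleftrightarrow>
     \<not> (\<exists>F F'. F \<subseteq> A \<and> F' \<subseteq> A \<and> zero_locus X F \<noteq> {} \<and> zero_locus X F' \<noteq> {} \<and>
          zero_locus X F \<inter> zero_locus X F' = {} \<and> zero_locus X F \<union> zero_locus X F' = X)"

text \<open>
  Multiplication is a morphism: the comorphism sends \<open>A\<close> into the algebra of functions
  on \<open>G \<times> G\<close> of the form \<open>\<Sum>i. a\<^sub>i(x) b\<^sub>i(y)\<close>, i.e. into \<open>A \<otimes> A\<close>.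
\<close>

definition affine_algebraic_group :: "'g monoid \<Rightarrow> ('g \<Rightarrow> 'k::field) set \<Rightarrow> bool" where
  "affine_algebraic_group G A \<longleftrightarrow>
     group G \<and> affine_variety (carrier G) A \<and>
     (\<forall>f\<in>A. \<exists>(n::nat) a b. (\<forall>i<n. a i \<in> A \<and> b i \<in> A) \<and>
        (\<forall>x\<in>carrier G. \<forall>y\<in>carrier G. f (x \<otimes>\<^bsub>G\<^esub> y) = (\<Sum>i<n. a i x * b i y))) \<and>
     (\<forall>f\<in>A. (\<lambda>x\<in>carrier G. f (inv\<^bsub>G\<^esub> x)) \<in> A)"

definition left_translate :: "'g monoid \<Rightarrow> 'g \<Rightarrow> ('g \<Rightarrow> 'k::field) \<Rightarrow> ('g \<Rightarrow> 'k)" where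
  "left_translate G x f = (\<lambda>y\<in>carrier G. f (inv\<^bsub>G\<^esub> x \<otimes>\<^bsub>G\<^esub> y))"

text \<open>The Lie algebra of \<open>G\<close>: left invariant derivations of the coordinate algebra.\<close>

definition group_lie_algebra ::
  "'g monoid \<Rightarrow> ('g \<Rightarrow> 'k::field) set \<Rightarrow> (('g \<Rightarrow> 'k) \<Rightarrow> ('g \<Rightarrow> 'k)) set" where
  "group_lie_algebra G A = {D \<in> A \<rightarrow>\<^sub>E A.
     (\<forall>f\<in>A. \<forall>g\<in>A. D (\<lambda>x\<in>carrier G. f x + g x) = (\<lambda>x\<in>carrier G. D f x + D g x)) \<and>
     (\<forall>c. \<forall>f\<in>A. D (\<lambda>x\<in>carrier G. c * f x) = (\<lambda>x\<in>carrier G. c * D f x)) \<and>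
     (\<forall>f\<in>A. \<forall>g\<in>A. D (\<lambda>x\<in>carrier G. f x * g x) = (\<lambda>x\<in>carrier G. D f x * g x + f x * D g x)) \<and>
     (\<forall>x\<in>carrier G. \<forall>f\<in>A. D (left_translate G x f) = left_translate G x (D f))}"

definition group_lie_add ::
  "'g monoid \<Rightarrow> ('g \<Rightarrow> 'k::field) set \<Rightarrow> (('g \<Rightarrow> 'k) \<Rightarrow> ('g \<Rightarrow> 'k)) \<Rightarrow> (('g \<Rightarrow> 'k) \<Rightarrow> ('g \<Rightarrow> 'k))
    \<Rightarrow> (('g \<Rightarrow> 'k) \<Rightarrow> ('g \<Rightarrow> 'k))" where
  "group_lie_add G A D E = (\<lambda>f\<in>A. \<lambda>x\<in>carrier G. D f x + E f x)"

definition group_lie_scale ::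
  "'g monoid \<Rightarrow> ('g \<Rightarrow> 'k::field) set \<Rightarrow> 'k \<Rightarrow> (('g \<Rightarrow> 'k) \<Rightarrow> ('g \<Rightarrow> 'k)) \<Rightarrow> (('g \<Rightarrow> 'k) \<Rightarrow> ('g \<Rightarrow> 'k))" where
  "group_lie_scale G A c D = (\<lambda>f\<in>A. \<lambda>x\<in>carrier G. c * D f x)"

definition group_lie_bracket ::
  "'g monoid \<Rightarrow> ('g \<Rightarrow> 'k::field) set \<Rightarrow> (('g \<Rightarrow> 'k) \<Rightarrow> ('g \<Rightarrow> 'k)) \<Rightarrow> (('g \<Rightarrow> 'k) \<Rightarrow> ('g \<Rightarrow> 'k))
    \<Rightarrow> (('g \<Rightarrow> 'k) \<Rightarrow> ('g \<Rightarrow> 'k))" where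
  "group_lie_bracket G A D E = (\<lambda>f\<in>A. \<lambda>x\<in>carrier G. D (E f) x - E (D f) x)"

text \<open>
  The first argument only names the type in which the points of the group live; HOL cannot
  quantify over types inside a definition.  A theorem with this predicate as a hypothesis and
  \<open>'g\<close> free applies to groups on arbitrary types.
\<close>

definition algebraic_lie_algebra ::
  "'g itself \<Rightarrow> ('k::field \<Rightarrow> 'q::ab_group_add \<Rightarrow> 'q) \<Rightarrow> ('q \<Rightarrow> 'q \<Rightarrow> 'q) \<Rightarrow> bool" where
  "algebraic_lie_algebra _ scale br \<longleftrightarrow>
     lie_algebra scale br \<and>
     (\<exists>(G :: 'g monoid) (A :: ('g \<Rightarrow> 'k) set) \<phi>.
        affine_algebraic_group G A \<and> zariski_connected (carrier G) A \<and>
        bij_betw \<phi> UNIV (group_lie_algebra G A) \<and>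
        (\<forall>x y. \<phi> (x + y) = group_lie_add G A (\<phi> x) (\<phi> y)) \<and>
        (\<forall>c x. \<phi> (scale c x) = group_lie_scale G A c (\<phi> x)) \<and>
        (\<forall>x y. \<phi> (br x y) = group_lie_bracket G A (\<phi> x) (\<phi> y)))"


section \<open>The symmetric algebra\<close>

text \<open>
  The symmetric algebra of \<open>'q\<close> is the free commutative algebra on one variable \<open>X\<^sub>v\<close> for every
  vector \<open>v\<close>, modulo the ideal that makes \<open>v \<mapsto> X\<^sub>v\<close> linear.
\<close>

type_synonym ('k, 'q) free_alg = "('q \<Rightarrow>\<^sub>0 nat) \<Rightarrow>\<^sub>0 'k"

definition free_var :: "'q \<Rightarrow> ('k::comm_ring_1, 'q) free_alg" where
  "free_var v = Poly_Mapping.single (Poly_Mapping.single v 1) 1"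

definition free_const :: "'k::comm_ring_1 \<Rightarrow> ('k, 'q) free_alg" where
  "free_const c = Poly_Mapping.single 0 c"

definition free_ring :: "('k::comm_ring_1, 'q) free_alg ring" where
  "free_ring = \<lparr>carrier = UNIV, mult = (*), one = 1, zero = 0, add = (+)\<rparr>"

definition sym_ideal :: "('k::field \<Rightarrow> 'q::ab_group_add \<Rightarrow> 'q) \<Rightarrow> ('k, 'q) free_alg set" where
  "sym_ideal scale = Idl\<^bsub>free_ring\<^esub>
     ({free_var (v + w) - (free_var v + free_var w) | v w. True} \<union>
      {free_var (scale c v) - free_const c * free_var v | c v. True})"

definition sym_class :: "('k::field \<Rightarrow> 'q::ab_group_add \<Rightarrow> 'q) \<Rightarrow> ('k, 'q) free_alg \<Rightarrow> ('k, 'q) free_alg set" where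
  "sym_class scale f = sym_ideal scale +>\<^bsub>free_ring\<^esub> f"

definition sym_algebra ::
  "('k::field \<Rightarrow> 'q::ab_group_add \<Rightarrow> 'q) \<Rightarrow> ('k, ('k, 'q) free_alg set) module" where
  "sym_algebra scale =
     ring.extend (free_ring Quot sym_ideal scale)
       \<lparr>smult = (\<lambda>c s. sym_class scale (free_const c) \<otimes>\<^bsub>free_ring Quot sym_ideal scale\<^esub> s)\<rparr>"

definition sym_emb :: "('k::field \<Rightarrow> 'q::ab_group_add \<Rightarrow> 'q) \<Rightarrow> 'q \<Rightarrow> ('k, 'q) free_alg set" where
  "sym_emb scale v = sym_class scale (free_var v)"


section \<open>Poisson brackets on a commutative algebra\<close>

text \<open>
  Brackets on \<open>S\<close> are extensional functions on its carrier, so that two brackets are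
  equal iff they agree on \<open>S\<close>.
\<close>

definition biderivation :: "('k::field, 's) module \<Rightarrow> ('s \<Rightarrow> 's \<Rightarrow> 's) \<Rightarrow> bool" where
  "biderivation S P \<longleftrightarrow>
     P \<in> carrier S \<rightarrow>\<^sub>E (carrier S \<rightarrow>\<^sub>E carrier S) \<and>
     (\<forall>f\<in>carrier S. \<forall>g\<in>carrier S. \<forall>h\<in>carrier S. \<forall>a b.
        P (a \<odot>\<^bsub>S\<^esub> f \<oplus>\<^bsub>S\<^esub> b \<odot>\<^bsub>S\<^esub> g) h = a \<odot>\<^bsub>S\<^esub> P f h \<oplus>\<^bsub>S\<^esub> b \<odot>\<^bsub>S\<^esub> P g h \<and>
        P h (a \<odot>\<^bsub>S\<^esub> f \<oplus>\<^bsub>S\<^esub> b \<odot>\<^bsub>S\<^esub> g) = a \<odot>\<^bsub>S\<^esub> P h f \<oplus>\<^bsub>S\<^esub> b \<odot>\<^bsub>S\<^esub> P h g) \<and>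
     (\<forall>f\<in>carrier S. \<forall>g\<in>carrier S. \<forall>h\<in>carrier S.
        P (f \<otimes>\<^bsub>S\<^esub> g) h = f \<otimes>\<^bsub>S\<^esub> P g h \<oplus>\<^bsub>S\<^esub> P f h \<otimes>\<^bsub>S\<^esub> g \<and>
        P h (f \<otimes>\<^bsub>S\<^esub> g) = f \<otimes>\<^bsub>S\<^esub> P h g \<oplus>\<^bsub>S\<^esub> P h f \<otimes>\<^bsub>S\<^esub> g)"

definition poisson_bracket :: "('k::field, 's) module \<Rightarrow> ('s \<Rightarrow> 's \<Rightarrow> 's) \<Rightarrow> bool" where
  "poisson_bracket S P \<longleftrightarrow>
     biderivation S P \<and>
     (\<forall>f\<in>carrier S. P f f = \<zero>\<^bsub>S\<^esub>) \<and>
     (\<forall>f\<in>carrier S. \<forall>g\<in>carrier S. \<forall>h\<in>carrier S.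
        P f (P g h) \<oplus>\<^bsub>S\<^esub> P g (P h f) \<oplus>\<^bsub>S\<^esub> P h (P f g) = \<zero>\<^bsub>S\<^esub>)"

definition bracket_comb ::
  "('k::field, 's) module \<Rightarrow> 'k \<Rightarrow> ('s \<Rightarrow> 's \<Rightarrow> 's) \<Rightarrow> 'k \<Rightarrow> ('s \<Rightarrow> 's \<Rightarrow> 's) \<Rightarrow> ('s \<Rightarrow> 's \<Rightarrow> 's)" where
  "bracket_comb S a P b Q =
     (\<lambda>f\<in>carrier S. \<lambda>g\<in>carrier S. a \<odot>\<^bsub>S\<^esub> P f g \<oplus>\<^bsub>S\<^esub> b \<odot>\<^bsub>S\<^esub> Q f g)"

definition compatible :: "('k::field, 's) module \<Rightarrow> ('s \<Rightarrow> 's \<Rightarrow> 's) \<Rightarrow> ('s \<Rightarrow> 's \<Rightarrow> 's) \<Rightarrow> bool" where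
  "compatible S P Q \<longleftrightarrow>
     poisson_bracket S P \<and> poisson_bracket S Q \<and>
     (\<forall>a b. poisson_bracket S (bracket_comb S a P b Q))"

definition pencil :: "('k::field, 's) module \<Rightarrow> ('s \<Rightarrow> 's \<Rightarrow> 's) \<Rightarrow> ('s \<Rightarrow> 's \<Rightarrow> 's) \<Rightarrow> ('s \<Rightarrow> 's \<Rightarrow> 's) set" where
  "pencil S P Q = {bracket_comb S a P b Q | a b. True}"

text \<open>The unique extension of a bilinear operation on \<open>'q\<close> by the Leibniz rule.\<close>

definition leibniz_extension ::
  "('k::field \<Rightarrow> 'q::ab_group_add \<Rightarrow> 'q) \<Rightarrow> ('q \<Rightarrow> 'q \<Rightarrow> 'q) \<Rightarrow>
     (('k, 'q) free_alg set \<Rightarrow> ('k, 'q) free_alg set \<Rightarrow> ('k, 'q) free_alg set)" where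
  "leibniz_extension scale \<beta> = (THE P. biderivation (sym_algebra scale) P \<and>
     (\<forall>x y. P (sym_emb scale x) (sym_emb scale y) = sym_emb scale (\<beta> x y)))"


section \<open>The two brackets attached to an automorphism of finite order\<close>

definition eigencomponent ::
  "('k::field \<Rightarrow> 'q::ab_group_add \<Rightarrow> 'q) \<Rightarrow> ('q \<Rightarrow> 'q) \<Rightarrow> 'k \<Rightarrow> nat \<Rightarrow> 'q set" where
  "eigencomponent scale \<theta> \<zeta> j = {x. \<theta> x = scale (\<zeta> ^ j) x}"

definition bracket_zero ::
  "('k::field \<Rightarrow> 'q::ab_group_add \<Rightarrow> 'q) \<Rightarrow> ('q \<Rightarrow> 'q \<Rightarrow> 'q) \<Rightarrow> ('q \<Rightarrow> 'q) \<Rightarrow> nat \<Rightarrow> 'k \<Rightarrow> 'q \<Rightarrow> 'q \<Rightarrow> 'q" where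
  "bracket_zero scale br \<theta> m \<zeta> = (THE \<beta>. bilinear_map scale \<beta> \<and>
     (\<forall>i<m. \<forall>j<m. \<forall>x\<in>eigencomponent scale \<theta> \<zeta> i. \<forall>y\<in>eigencomponent scale \<theta> \<zeta> j.
        \<beta> x y = (if i + j < m then br x y else 0)))"

definition bracket_infinity ::
  "('k::field \<Rightarrow> 'q::ab_group_add \<Rightarrow> 'q) \<Rightarrow> ('q \<Rightarrow> 'q \<Rightarrow> 'q) \<Rightarrow> ('q \<Rightarrow> 'q) \<Rightarrow> nat \<Rightarrow> 'k \<Rightarrow> 'q \<Rightarrow> 'q \<Rightarrow> 'q" where
  "bracket_infinity scale br \<theta> m \<zeta> = (THE \<beta>. bilinear_map scale \<beta> \<and>
     (\<forall>i<m. \<forall>j<m. \<forall>x\<in>eigencomponent scale \<theta> \<zeta> i. \<forall>y\<in>eigencomponent scale \<theta> \<zeta> j.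
        \<beta> x y = (if i + j < m then 0 else br x y)))"

end

theory Submission
  imports Defs
begin

text \<open>
  Decompose \<open>\<qq>\<close> into the eigenspaces \<open>\<qq>\<^sub>i\<close> of \<open>\<theta>\<close> and let \<open>\<beta>\<close> be the bracket that multiplies
  \<open>[x, y]\<close> for \<open>x \<in> \<qq>\<^sub>i\<close>, \<open>y \<in> \<qq>\<^sub>j\<close> by \<open>a\<close> if \<open>i + j < m\<close> and by \<open>b\<close> otherwise
  (\<open>graded_bracket\<close>).  The factor records whether adding the residues \<open>i\<close> and \<open>j\<close> produces
  a carry.  In a nested bracket \<open>\<beta> x (\<beta> y z)\<close> of eigenvectors of weights \<open>i, j, k\<close> the total number
  of carries is \<open>(i + j + k) div m\<close>, which is at most \<open>2\<close> and symmetric in \<open>i, j, k\<close>.  So the three terms of the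
  Jacobi identity of \<open>\<beta>\<close> are those of the Jacobi identity of \<open>[ , ]\<close>, all multiplied by
  the same one of \<open>a\<^sup>2\<close>, \<open>a b\<close>, \<open>b\<^sup>2\<close>: for all \<open>a\<close> and \<open>b\<close>, \<open>\<beta>\<close> is a Lie bracket.  Its values at
  \<open>(a, b) = (1, 0)\<close>, \<open>(0, 1)\<close> and \<open>(1, 1)\<close> are \<open>{ , }\<^sub>0\<close>, \<open>{ , }\<^sub>\<infinity>\<close> and the initial bracket.

  It remains to pass from \<open>\<qq>\<close> to its symmetric algebra.  Three facts suffice: a bilinear
  operation extends uniquely to a biderivation, the extension depends linearly on the operation
  (\<open>bracket_comb_sym_bracket\<close>), and the extension of a Lie bracket is a Poisson bracket
  (\<open>lie_algebra_poisson_bracket\<close>).  Uniqueness, skew symmetry and the Jacobi identity of the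
  extension all follow from one principle: a derivation is determined by its values on
  generators.  The calculations take place in the free commutative algebra, where
  derivations may be prescribed on the variables and the Leibniz rule is an equation
  in a commutative ring; the identities that follow from bilinearity, skew symmetry or the Jacobi
  identity on \<open>\<qq>\<close> hold there only modulo the ideal that defines the symmetric algebra.
\<close>

section \<open>Derivations of the free commutative algebra\<close>

lemma free_const_0 [simp]: "free_const 0 = 0"
  and free_const_1 [simp]: "free_const 1 = 1"
  by (simp_all add: free_const_def)

lemma free_const_add: "free_const (a + b) = free_const a + free_const b"
  by (simp add: free_const_def single_add)

lemma free_const_mult: "free_const (a * b) = free_const a * free_const b"
  by (simp add: free_const_def mult_single)

lemma poly_mapping_eq_sum_single:
  "f = (\<Sum>t\<in>Poly_Mapping.keys f. Poly_Mapping.single t (Poly_Mapping.lookup f t))"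
  by (rule poly_mapping_eqI)
     (simp add: lookup_sum lookup_single when_def in_keys_iff sum.If_cases)

lemma free_alg_single: "Poly_Mapping.single t c = free_const c * Poly_Mapping.single t 1"
  by (simp add: free_const_def mult_single)

lemma free_alg_induct [case_names const var add mult]:
  fixes f :: "('k::comm_ring_1, 'q) free_alg"
  assumes const: "\<And>c. P (free_const c)" and var: "\<And>v. P (free_var v)"
    and add: "\<And>f g. P f \<Longrightarrow> P g \<Longrightarrow> P (f + g)" and mult: "\<And>f g. P f \<Longrightarrow> P g \<Longrightarrow> P (f * g)"
  shows "P f"
proof -
  have one: "P 1" using const[of 1] by simp
  have pow: "P (Poly_Mapping.single (Poly_Mapping.single v n) 1)" for v :: 'q and n
  proof (induction n)
    case 0
    show ?case using one by simp
  next
    case (Suc n)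
    have "Poly_Mapping.single (Poly_Mapping.single v (Suc n)) (1::'k)
        = free_var v * Poly_Mapping.single (Poly_Mapping.single v n) 1"
      by (simp add: free_var_def mult_single flip: single_add)
    then show ?case using mult[OF var Suc.IH] by simp
  qed
  have prod: "P (\<Prod>v\<in>V. Poly_Mapping.single (Poly_Mapping.single v (n v)) 1)" if "finite V" for V and n :: "'q \<Rightarrow> nat"
    using that by induction (simp_all add: one mult pow)
  have mon_prod: "Poly_Mapping.single (\<Sum>v\<in>V. h v) (1::'k) = (\<Prod>v\<in>V. Poly_Mapping.single (h v) 1)"
    if "finite V" for V :: "'q set" and h :: "'q \<Rightarrow> 'q \<Rightarrow>\<^sub>0 nat"
    using that by induction (simp_all flip: mult_single[where a=1 and b="1::'k", simplified])
  have mon: "P (Poly_Mapping.single t 1)" for t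
    using prod[of "Poly_Mapping.keys t" "Poly_Mapping.lookup t"]
      mon_prod[of "Poly_Mapping.keys t" "\<lambda>v. Poly_Mapping.single v (Poly_Mapping.lookup t v)"]
    by (simp flip: poly_mapping_eq_sum_single)
  have single: "P (Poly_Mapping.single t c)" for t c
    using mult[OF const mon] by (simp flip: free_alg_single)
  have "P (\<Sum>t\<in>T. Poly_Mapping.single t (Poly_Mapping.lookup f t))" if "finite T" for T
    using that by (induction rule: finite_induct) (use const[of 0] in \<open>auto intro: add single\<close>)
  from this[of "Poly_Mapping.keys f"] show ?thesis
    by (simp flip: poly_mapping_eq_sum_single)
qed

text \<open>
  The chain rule \<open>\<Sum>\<^sub>v (\<partial>t/\<partial>X\<^sub>v) \<delta>(v)\<close> for a monomial with exponent function \<open>t\<close>.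
\<close>

definition monomial_deriv :: "('q \<Rightarrow> ('k::comm_ring_1, 'q) free_alg) \<Rightarrow> ('q \<Rightarrow>\<^sub>0 nat) \<Rightarrow> ('k, 'q) free_alg" where
  "monomial_deriv \<delta> t = (\<Sum>v\<in>Poly_Mapping.keys t.
     of_nat (Poly_Mapping.lookup t v) * Poly_Mapping.single (t - Poly_Mapping.single v 1) 1 * \<delta> v)"

text \<open>
  The derivation over the coefficient ring with \<open>X\<^sub>v \<mapsto> \<delta>(v)\<close>.
\<close>

definition free_deriv :: "('q \<Rightarrow> ('k::comm_ring_1, 'q) free_alg) \<Rightarrow> ('k, 'q) free_alg \<Rightarrow> ('k, 'q) free_alg" where
  "free_deriv \<delta> f = (\<Sum>t\<in>Poly_Mapping.keys f.
     free_const (Poly_Mapping.lookup f t) * monomial_deriv \<delta> t)"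

lemma monomial_deriv_superset:
  assumes "finite V" "Poly_Mapping.keys t \<subseteq> V"
  shows "monomial_deriv \<delta> t = (\<Sum>v\<in>V.
     of_nat (Poly_Mapping.lookup t v) * Poly_Mapping.single (t - Poly_Mapping.single v 1) 1 * \<delta> v)"
  unfolding monomial_deriv_def
  by (rule sum.mono_neutral_left) (use assms in \<open>auto simp: in_keys_iff\<close>)

lemma free_deriv_superset:
  assumes "finite T" "Poly_Mapping.keys f \<subseteq> T"
  shows "free_deriv \<delta> f = (\<Sum>t\<in>T. free_const (Poly_Mapping.lookup f t) * monomial_deriv \<delta> t)"
  unfolding free_deriv_def
  by (rule sum.mono_neutral_left) (use assms in \<open>auto simp: in_keys_iff\<close>)

lemma free_deriv_add: "free_deriv \<delta> (f + g) = free_deriv \<delta> f + free_deriv \<delta> g"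
proof -
  let ?T = "Poly_Mapping.keys f \<union> Poly_Mapping.keys g"
  have "Poly_Mapping.keys (f + g) \<subseteq> ?T" by (rule keys_add)
  then show ?thesis
    by (simp add: free_deriv_superset[where T = ?T] lookup_add free_const_add sum.distrib algebra_simps)
qed

lemma free_deriv_single: "free_deriv \<delta> (Poly_Mapping.single t c) = free_const c * monomial_deriv \<delta> t"
  by (cases "c = 0") (simp_all add: free_deriv_def)

lemma free_deriv_0 [simp]: "free_deriv \<delta> 0 = 0"
  by (simp add: free_deriv_def)

lemma free_deriv_const [simp]: "free_deriv \<delta> (free_const c) = 0"
  by (simp add: free_const_def free_deriv_single monomial_deriv_def)

lemma free_deriv_var [simp]: "free_deriv \<delta> (free_var v) = \<delta> v"
  by (simp add: free_var_def free_deriv_single monomial_deriv_def)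

lemma free_deriv_uminus: "free_deriv \<delta> (- f) = - free_deriv \<delta> f"
  using free_deriv_add[of \<delta> f "- f"] by (simp add: eq_neg_iff_add_eq_0 add.commute)

lemma free_deriv_diff: "free_deriv \<delta> (f - g) = free_deriv \<delta> f - free_deriv \<delta> g"
  using free_deriv_add[of \<delta> f "- g"] by (simp add: free_deriv_uminus)

text \<open>
  The truncated difference \<open>s - 1\<close> at \<open>v\<close> is a genuine one unless \<open>s\<close> vanishes at \<open>v\<close>; in that case the
  coefficient kills both sides.
\<close>

lemma monomial_shift:
  "of_nat (Poly_Mapping.lookup s v) * Poly_Mapping.single (s + t - Poly_Mapping.single v 1) (1::'k::comm_ring_1)
     = of_nat (Poly_Mapping.lookup s v) * Poly_Mapping.single (s - Poly_Mapping.single v 1) 1 * Poly_Mapping.single t 1"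
proof (cases "Poly_Mapping.lookup s v = 0")
  case False
  have "s + t - Poly_Mapping.single v 1 = (s - Poly_Mapping.single v 1) + t"
    by (rule poly_mapping_eqI) (use False in \<open>auto simp: lookup_add lookup_minus lookup_single when_def\<close>)
  then show ?thesis by (simp add: mult_single mult.assoc)
qed simp

lemma monomial_deriv_add:
  "monomial_deriv \<delta> (s + t) = Poly_Mapping.single s 1 * monomial_deriv \<delta> t + Poly_Mapping.single t 1 * monomial_deriv \<delta> s"
proof -
  let ?V = "Poly_Mapping.keys s \<union> Poly_Mapping.keys t"
  have sub: "Poly_Mapping.keys (s + t) \<subseteq> ?V" by (rule keys_add)
  have "of_nat (Poly_Mapping.lookup (s + t) v) * Poly_Mapping.single (s + t - Poly_Mapping.single v 1) 1 * \<delta> v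
      = Poly_Mapping.single s 1 * (of_nat (Poly_Mapping.lookup t v) * Poly_Mapping.single (t - Poly_Mapping.single v 1) 1 * \<delta> v)
      + Poly_Mapping.single t 1 * (of_nat (Poly_Mapping.lookup s v) * Poly_Mapping.single (s - Poly_Mapping.single v 1) 1 * \<delta> v)" for v
    using monomial_shift[of s v t, where 'k='b] monomial_shift[of t v s, where 'k='b]
    by (simp add: lookup_add algebra_simps)
  then show ?thesis using sub
    by (simp add: monomial_deriv_superset[where V = ?V] sum.distrib sum_distrib_left)
qed

text \<open>
  Both sides are bilinear, so the Leibniz rule reduces to the case of two monomials.
\<close>

lemma free_deriv_mult:
  fixes f g :: "('k::comm_ring_1, 'q) free_alg"
  shows "free_deriv \<delta> (f * g) = f * free_deriv \<delta> g + g * free_deriv \<delta> f"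
proof -
  have single: "free_deriv \<delta> (Poly_Mapping.single s a * Poly_Mapping.single t b)
      = Poly_Mapping.single s a * free_deriv \<delta> (Poly_Mapping.single t b)
      + Poly_Mapping.single t b * free_deriv \<delta> (Poly_Mapping.single s a)" for s t a b
    unfolding mult_single free_deriv_single monomial_deriv_add free_const_mult
    unfolding free_alg_single[of s a] free_alg_single[of t b]
    by (simp add: algebra_simps)
  have sums: "free_deriv \<delta> (sum h T) = (\<Sum>t\<in>T. free_deriv \<delta> (h t))" for h and T :: "('q \<Rightarrow>\<^sub>0 nat) set"
    by (induction T rule: infinite_finite_induct) (simp_all add: free_deriv_add)
  have "free_deriv \<delta> (sum h S * sum k T) = sum h S * free_deriv \<delta> (sum k T) + sum k T * free_deriv \<delta> (sum h S)"
    if "\<And>s t. free_deriv \<delta> (h s * k t) = h s * free_deriv \<delta> (k t) + k t * free_deriv \<delta> (h s)"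
    for h k and S T :: "('q \<Rightarrow>\<^sub>0 nat) set"
  proof -
    have "free_deriv \<delta> (sum h S * sum k T) = (\<Sum>s\<in>S. \<Sum>t\<in>T. h s * free_deriv \<delta> (k t) + k t * free_deriv \<delta> (h s))"
      by (simp add: sum_product sums that)
    also have "\<dots> = (\<Sum>s\<in>S. \<Sum>t\<in>T. h s * free_deriv \<delta> (k t)) + (\<Sum>t\<in>T. \<Sum>s\<in>S. k t * free_deriv \<delta> (h s))"
      by (simp add: sum.distrib sum.swap[of _ T S])
    finally show ?thesis by (simp add: sum_product sums)
  qed
  from this[of "\<lambda>s. Poly_Mapping.single s (Poly_Mapping.lookup f s)" "\<lambda>t. Poly_Mapping.single t (Poly_Mapping.lookup g t)"
      "Poly_Mapping.keys f" "Poly_Mapping.keys g", OF single]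
  show ?thesis by (simp flip: poly_mapping_eq_sum_single)
qed

lemma free_deriv_rule_add: "free_deriv (\<lambda>v. \<delta> v + \<epsilon> v) f = free_deriv \<delta> f + free_deriv \<epsilon> f"
  by (simp add: free_deriv_def monomial_deriv_def algebra_simps sum.distrib)

lemma free_deriv_rule_mult: "free_deriv (\<lambda>v. a * \<delta> v) f = a * free_deriv \<delta> f"
  by (simp add: free_deriv_def monomial_deriv_def sum_distrib_left algebra_simps)

lemma free_deriv_rule_uminus: "free_deriv (\<lambda>v. - \<delta> v) f = - free_deriv \<delta> f"
  using free_deriv_rule_mult[of "-1" \<delta> f] by simp

lemma free_deriv_rule_diff: "free_deriv (\<lambda>v. \<delta> v - \<epsilon> v) f = free_deriv \<delta> f - free_deriv \<epsilon> f"
  using free_deriv_rule_add[of \<delta> "\<lambda>v. - \<epsilon> v"] by (simp add: free_deriv_rule_uminus)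

text \<open>
  The derivation that sends \<open>X\<^sub>v\<close> to the value at \<open>g\<close> of the derivation \<open>X\<^sub>w \<mapsto> X\<close> with index \<open>\<beta> v w\<close>.  It is a
  derivation in \<open>g\<close> as well because \<^term>\<open>free_deriv \<delta> f\<close> depends on \<open>\<delta>\<close> linearly over the whole polynomial ring.
\<close>

definition free_bracket :: "('q \<Rightarrow> 'q \<Rightarrow> 'q) \<Rightarrow> ('k::comm_ring_1, 'q) free_alg \<Rightarrow> ('k, 'q) free_alg \<Rightarrow> ('k, 'q) free_alg" where
  "free_bracket \<beta> f g = free_deriv (\<lambda>v. free_deriv (\<lambda>w. free_var (\<beta> v w)) g) f"

lemma free_bracket_add_left: "free_bracket \<beta> (f + g) h = free_bracket \<beta> f h + free_bracket \<beta> g h"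
  and free_bracket_diff_left: "free_bracket \<beta> (f - g) h = free_bracket \<beta> f h - free_bracket \<beta> g h"
  and free_bracket_mult_left: "free_bracket \<beta> (f * g) h = f * free_bracket \<beta> g h + g * free_bracket \<beta> f h"
  and free_bracket_const_left [simp]: "free_bracket \<beta> (free_const c) h = 0"
  and free_bracket_add_right: "free_bracket \<beta> h (f + g) = free_bracket \<beta> h f + free_bracket \<beta> h g"
  and free_bracket_diff_right: "free_bracket \<beta> h (f - g) = free_bracket \<beta> h f - free_bracket \<beta> h g"
  and free_bracket_mult_right: "free_bracket \<beta> h (f * g) = f * free_bracket \<beta> h g + g * free_bracket \<beta> h f"
  and free_bracket_var_left: "free_bracket \<beta> (free_var v) h = free_deriv (\<lambda>w. free_var (\<beta> v w)) h"
  by (simp_all add: free_bracket_def free_deriv_add free_deriv_diff free_deriv_mult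
      free_deriv_rule_add free_deriv_rule_diff free_deriv_rule_mult)

lemma free_bracket_const_right [simp]: "free_bracket \<beta> h (free_const c) = 0"
  using free_deriv_rule_mult[of 0 "\<lambda>_. 0" h] by (simp add: free_bracket_def)

lemma free_bracket_zero_right [simp]: "free_bracket \<beta> h 0 = 0"
  using free_bracket_const_right[of \<beta> h 0] by simp

section \<open>The symmetric algebra as a quotient\<close>

lemma cring_free_ring: "cring (free_ring :: ('k::comm_ring_1, 'q) free_alg ring)"
proof (rule cringI)
  have "\<exists>y. y + x = 0 \<and> x + y = 0" for x :: "('k, 'q) free_alg"
    by (rule exI[of _ "- x"]) simp
  then show "abelian_group (free_ring :: ('k, 'q) free_alg ring)"
    by (intro abelian_groupI) (auto simp: free_ring_def add_ac)
  show "comm_monoid (free_ring :: ('k, 'q) free_alg ring)"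
    by unfold_locales (auto simp: free_ring_def mult_ac)
qed (auto simp: free_ring_def algebra_simps)

lemma ideal_free_ringI:
  fixes J :: "('k::comm_ring_1, 'q) free_alg set"
  assumes "0 \<in> J" and add: "\<And>f g. f \<in> J \<Longrightarrow> g \<in> J \<Longrightarrow> f + g \<in> J" and mult: "\<And>f g. g \<in> J \<Longrightarrow> f * g \<in> J"
  shows "ideal J free_ring"
proof (rule idealI)
  interpret cring "free_ring :: ('k, 'q) free_alg ring" by (rule cring_free_ring)
  show "ring (free_ring :: ('k, 'q) free_alg ring)" by (rule ring_axioms)
  have neg: "inv\<^bsub>add_monoid free_ring\<^esub> f = - f" for f :: "('k, 'q) free_alg"
    using minus_equality[of "- f" f] by (simp add: free_ring_def a_inv_def)
  have "- f \<in> J" if "f \<in> J" for f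
    using mult[OF that, of "-1"] by simp
  then show "subgroup J (add_monoid free_ring)"
    using assms neg by (intro subgroup.intro) (auto simp: free_ring_def)
qed (use mult in \<open>auto simp: free_ring_def mult.commute\<close>)

context
  fixes scale :: "'k::field \<Rightarrow> 'q::ab_group_add \<Rightarrow> 'q"
begin

lemma ideal_sym_ideal: "ideal (sym_ideal scale) free_ring"
proof -
  interpret cring "free_ring :: ('k, 'q) free_alg ring" by (rule cring_free_ring)
  show ?thesis unfolding sym_ideal_def by (rule genideal_ideal) (simp add: free_ring_def)
qed

lemma sym_ideal_zero [simp]: "0 \<in> sym_ideal scale"
  and sym_ideal_add: "f \<in> sym_ideal scale \<Longrightarrow> g \<in> sym_ideal scale \<Longrightarrow> f + g \<in> sym_ideal scale"
  and sym_ideal_mult: "g \<in> sym_ideal scale \<Longrightarrow> f * g \<in> sym_ideal scale"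
proof -
  interpret ideal "sym_ideal scale" free_ring by (rule ideal_sym_ideal)
  show "0 \<in> sym_ideal scale" using additive_subgroup.zero_closed[OF is_additive_subgroup] by (simp add: free_ring_def)
  show "f \<in> sym_ideal scale \<Longrightarrow> g \<in> sym_ideal scale \<Longrightarrow> f + g \<in> sym_ideal scale"
    using additive_subgroup.a_closed[OF is_additive_subgroup] by (simp add: free_ring_def)
  show "g \<in> sym_ideal scale \<Longrightarrow> f * g \<in> sym_ideal scale"
    using I_l_closed by (simp add: free_ring_def)
qed

lemma sym_ideal_mult_right: "f \<in> sym_ideal scale \<Longrightarrow> f * g \<in> sym_ideal scale"
  using sym_ideal_mult[of f g] by (simp add: mult.commute)

lemma sym_ideal_uminus: "f \<in> sym_ideal scale \<Longrightarrow> - f \<in> sym_ideal scale"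
  using sym_ideal_mult[of f "-1"] by simp

lemma sym_ideal_diff: "f \<in> sym_ideal scale \<Longrightarrow> g \<in> sym_ideal scale \<Longrightarrow> f - g \<in> sym_ideal scale"
  using sym_ideal_add[of f "- g"] by (simp add: sym_ideal_uminus)

lemma sym_ideal_sum: "(\<And>x. x \<in> X \<Longrightarrow> h x \<in> sym_ideal scale) \<Longrightarrow> sum h X \<in> sym_ideal scale"
  by (induction X rule: infinite_finite_induct) (auto intro: sym_ideal_add)

lemma sym_ideal_var_add: "free_var (v + w) - free_var v - free_var w \<in> sym_ideal scale"
  and sym_ideal_var_scale: "free_var (scale c v) - free_const c * free_var v \<in> sym_ideal scale"
proof -
  interpret cring "free_ring :: ('k, 'q) free_alg ring" by (rule cring_free_ring)
  have "{free_var (v + w) - (free_var v + free_var w) | v w. True} \<union>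
      {free_var (scale c v) - free_const c * free_var v | c v. True} \<subseteq> sym_ideal scale"
    unfolding sym_ideal_def by (rule genideal_self) (simp add: free_ring_def)
  then show "free_var (v + w) - free_var v - free_var w \<in> sym_ideal scale"
    "free_var (scale c v) - free_const c * free_var v \<in> sym_ideal scale"
    by (auto simp: diff_diff_eq)
qed

lemma sym_ideal_subset:
  assumes J: "0 \<in> J" "\<And>f g. f \<in> J \<Longrightarrow> g \<in> J \<Longrightarrow> f + g \<in> J" "\<And>f g. g \<in> J \<Longrightarrow> f * g \<in> J"
    and gens: "\<And>v w. free_var (v + w) - free_var v - free_var w \<in> J"
      "\<And>c v. free_var (scale c v) - free_const c * free_var v \<in> J"
  shows "sym_ideal scale \<subseteq> J"
proof -
  interpret cring "free_ring :: ('k, 'q) free_alg ring" by (rule cring_free_ring)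
  show ?thesis unfolding sym_ideal_def
    by (rule genideal_minimal) (use ideal_free_ringI[OF J] gens in \<open>auto simp: diff_diff_eq\<close>)
qed

text \<open>
  This turns equations in the symmetric algebra into ideal membership in a commutative
  ring, where polynomial identities can be proved by normalisation.
\<close>

lemma sym_class_eq_iff: "sym_class scale f = sym_class scale g \<longleftrightarrow> f - g \<in> sym_ideal scale"
proof -
  interpret ideal "sym_ideal scale" free_ring by (rule ideal_sym_ideal)
  have cls: "sym_class scale f = {h + f | h. h \<in> sym_ideal scale}" for f
    by (auto simp: sym_class_def a_r_coset_def' free_ring_def)
  show ?thesis
  proof
    assume "sym_class scale f = sym_class scale g"
    then have "0 + f \<in> {h + g | h. h \<in> sym_ideal scale}" unfolding cls using sym_ideal_zero by blast
    then show "f - g \<in> sym_ideal scale" by auto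
  next
    assume *: "f - g \<in> sym_ideal scale"
    have "\<exists>k. h + f = k + g \<and> k \<in> sym_ideal scale" if "h \<in> sym_ideal scale" for h
      using sym_ideal_add[OF that *] by (intro exI[of _ "h + (f - g)"]) simp
    moreover have "\<exists>k. h + g = k + f \<and> k \<in> sym_ideal scale" if "h \<in> sym_ideal scale" for h
      using sym_ideal_diff[OF that *] by (intro exI[of _ "h - (f - g)"]) simp
    ultimately show "sym_class scale f = sym_class scale g" unfolding cls by blast
  qed
qed

lemma carrier_sym_algebra: "carrier (sym_algebra scale) = range (sym_class scale)"
  by (auto simp: sym_algebra_def ring.defs FactRing_def A_RCOSETS_def' sym_class_def free_ring_def)

lemma sym_class_carrier [simp]: "sym_class scale f \<in> carrier (sym_algebra scale)"
  by (simp add: carrier_sym_algebra)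

lemma add_sym_class [simp]: "sym_class scale f \<oplus>\<^bsub>sym_algebra scale\<^esub> sym_class scale g = sym_class scale (f + g)"
  and mult_sym_class [simp]: "sym_class scale f \<otimes>\<^bsub>sym_algebra scale\<^esub> sym_class scale g = sym_class scale (f * g)"
  and smult_sym_class [simp]: "c \<odot>\<^bsub>sym_algebra scale\<^esub> sym_class scale g = sym_class scale (free_const c * g)"
  and zero_sym_class: "\<zero>\<^bsub>sym_algebra scale\<^esub> = sym_class scale 0"
proof -
  interpret ideal "sym_ideal scale" free_ring by (rule ideal_sym_ideal)
  let ?Q = "free_ring Quot sym_ideal scale"
  have hom: "sym_class scale \<in> ring_hom free_ring ?Q"
    using rcos_ring_hom by (simp add: sym_class_def[abs_def])
  have mult: "sym_class scale f \<otimes>\<^bsub>?Q\<^esub> sym_class scale g = sym_class scale (f * g)" for f g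
    using ring_hom_mult[OF hom] by (simp add: free_ring_def)
  show "sym_class scale f \<oplus>\<^bsub>sym_algebra scale\<^esub> sym_class scale g = sym_class scale (f + g)"
    using ring_hom_add[OF hom] by (simp add: sym_algebra_def ring.defs free_ring_def)
  show "sym_class scale f \<otimes>\<^bsub>sym_algebra scale\<^esub> sym_class scale g = sym_class scale (f * g)"
    "c \<odot>\<^bsub>sym_algebra scale\<^esub> sym_class scale g = sym_class scale (free_const c * g)"
    using mult by (simp_all add: sym_algebra_def ring.defs)
  show "\<zero>\<^bsub>sym_algebra scale\<^esub> = sym_class scale 0"
    using quotient_is_ring ring.ring_simprules(2) ring_hom_zero[OF hom ring_axioms quotient_is_ring]
    by (simp add: sym_algebra_def ring.defs free_ring_def)
qed

lemma sym_class_eq_zero_iff: "sym_class scale f = \<zero>\<^bsub>sym_algebra scale\<^esub> \<longleftrightarrow> f \<in> sym_ideal scale"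
  by (simp add: zero_sym_class sym_class_eq_iff)

text \<open>
  The quantifiers range over polynomials instead of classes, so that instances need no choice of
  representatives.
\<close>

definition sym_derivation :: "(('k, 'q) free_alg set \<Rightarrow> ('k, 'q) free_alg set) \<Rightarrow> bool" where
  "sym_derivation D \<longleftrightarrow>
     (\<forall>f. D (sym_class scale f) \<in> carrier (sym_algebra scale)) \<and>
     (\<forall>a b f g. D (sym_class scale (free_const a * f + free_const b * g))
        = a \<odot>\<^bsub>sym_algebra scale\<^esub> D (sym_class scale f) \<oplus>\<^bsub>sym_algebra scale\<^esub> b \<odot>\<^bsub>sym_algebra scale\<^esub> D (sym_class scale g)) \<and>
     (\<forall>f g. D (sym_class scale (f * g))
        = sym_class scale f \<otimes>\<^bsub>sym_algebra scale\<^esub> D (sym_class scale g)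
          \<oplus>\<^bsub>sym_algebra scale\<^esub> D (sym_class scale f) \<otimes>\<^bsub>sym_algebra scale\<^esub> sym_class scale g)"

lemma sym_derivation_lincomb:
  "sym_derivation D \<Longrightarrow> D (sym_class scale (free_const a * f + free_const b * g))
     = a \<odot>\<^bsub>sym_algebra scale\<^esub> D (sym_class scale f) \<oplus>\<^bsub>sym_algebra scale\<^esub> b \<odot>\<^bsub>sym_algebra scale\<^esub> D (sym_class scale g)"
  and sym_derivation_mult:
  "sym_derivation D \<Longrightarrow> D (sym_class scale (f * g))
     = sym_class scale f \<otimes>\<^bsub>sym_algebra scale\<^esub> D (sym_class scale g)
       \<oplus>\<^bsub>sym_algebra scale\<^esub> D (sym_class scale f) \<otimes>\<^bsub>sym_algebra scale\<^esub> sym_class scale g"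
  unfolding sym_derivation_def by blast+

text \<open>
  From \<open>1 = 1 \<cdot> 1\<close> one gets \<open>D 1 = D 1 + D 1\<close>.
\<close>

lemma sym_derivation_const:
  assumes D: "sym_derivation D"
  shows "D (sym_class scale (free_const c)) = sym_class scale 0"
proof -
  obtain u where u: "D (sym_class scale 1) = sym_class scale u"
    using D unfolding sym_derivation_def carrier_sym_algebra by blast
  have "u \<in> sym_ideal scale"
    using sym_derivation_mult[OF D, of 1 1] sym_ideal_uminus[of "u - (u + u)"]
    by (simp add: u sym_class_eq_iff)
  then show ?thesis
    using sym_derivation_lincomb[OF D, of c 1 0 1] by (simp add: u sym_class_eq_iff sym_ideal_mult)
qed

lemma sym_derivation_eqI:
  assumes D: "sym_derivation D" and E: "sym_derivation E"
    and eq: "\<And>v. D (sym_emb scale v) = E (sym_emb scale v)"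
  shows "D (sym_class scale f) = E (sym_class scale f)"
proof (induction f rule: free_alg_induct)
  case (const c)
  show ?case using sym_derivation_const[OF D] sym_derivation_const[OF E] by simp
next
  case (var v)
  show ?case using eq by (simp add: sym_emb_def)
next
  case (add f g)
  have "X (sym_class scale (f + g))
      = 1 \<odot>\<^bsub>sym_algebra scale\<^esub> X (sym_class scale f) \<oplus>\<^bsub>sym_algebra scale\<^esub> 1 \<odot>\<^bsub>sym_algebra scale\<^esub> X (sym_class scale g)"
    if "sym_derivation X" for X
    using sym_derivation_lincomb[OF that, of 1 f 1 g] by simp
  from this[OF D] this[OF E] show ?case using add by simp
next
  case (mult f g)
  then show ?case using D E by (simp add: sym_derivation_def)
qed

lemma biderivation_imp_derivation:
  assumes P: "biderivation (sym_algebra scale) P"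
  shows "sym_derivation (\<lambda>s. P s (sym_class scale h))" and "sym_derivation (P (sym_class scale h))"
proof -
  have "P (sym_class scale f) (sym_class scale g) \<in> carrier (sym_algebra scale)" for f g
    using P unfolding biderivation_def by (blast dest: PiE_mem[OF _ sym_class_carrier])
  moreover note lin = P[unfolded biderivation_def, THEN conjunct2, THEN conjunct1, rule_format,
      OF sym_class_carrier sym_class_carrier sym_class_carrier]
  moreover note mult = P[unfolded biderivation_def, THEN conjunct2, THEN conjunct2, rule_format,
      OF sym_class_carrier sym_class_carrier sym_class_carrier]
  ultimately show "sym_derivation (\<lambda>s. P s (sym_class scale h))" "sym_derivation (P (sym_class scale h))"
    unfolding sym_derivation_def smult_sym_class add_sym_class mult_sym_class by blast+
qed

lemma bracket_extensionalI:
  assumes P: "P \<in> carrier (sym_algebra scale) \<rightarrow>\<^sub>E (carrier (sym_algebra scale) \<rightarrow>\<^sub>E carrier (sym_algebra scale))"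
    and Q: "Q \<in> carrier (sym_algebra scale) \<rightarrow>\<^sub>E (carrier (sym_algebra scale) \<rightarrow>\<^sub>E carrier (sym_algebra scale))"
    and eq: "\<And>f g. P (sym_class scale f) (sym_class scale g) = Q (sym_class scale f) (sym_class scale g)"
  shows "P = Q"
proof (rule PiE_ext[OF P Q])
  fix s assume s: "s \<in> carrier (sym_algebra scale)"
  show "P s = Q s"
    by (rule PiE_ext[OF PiE_mem[OF P s] PiE_mem[OF Q s]]) (use s eq in \<open>auto simp: carrier_sym_algebra\<close>)
qed

lemma biderivation_eqI:
  assumes P: "biderivation (sym_algebra scale) P" and Q: "biderivation (sym_algebra scale) Q"
    and eq: "\<And>v w. P (sym_emb scale v) (sym_emb scale w) = Q (sym_emb scale v) (sym_emb scale w)"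
  shows "P = Q"
proof (rule bracket_extensionalI)
  have var: "P (sym_class scale f) (sym_emb scale w) = Q (sym_class scale f) (sym_emb scale w)" for f w
    using sym_derivation_eqI[OF biderivation_imp_derivation(1)[OF P] biderivation_imp_derivation(1)[OF Q]] eq
    by (metis sym_emb_def)
  show "P (sym_class scale f) (sym_class scale g) = Q (sym_class scale f) (sym_class scale g)" for f g
    by (rule sym_derivation_eqI[OF biderivation_imp_derivation(2)[OF P] biderivation_imp_derivation(2)[OF Q]])
       (rule var)
qed (use P Q in \<open>simp_all add: biderivation_def\<close>)

end

section \<open>Extension of bilinear operations by the Leibniz rule\<close>

lemma bilinear_map_iff:
  assumes "vector_space scale"
  shows "bilinear_map scale \<beta> \<longleftrightarrow>
    (\<forall>x y z. \<beta> (x + y) z = \<beta> x z + \<beta> y z) \<and> (\<forall>c x z. \<beta> (scale c x) z = scale c (\<beta> x z)) \<and>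
    (\<forall>x y z. \<beta> z (x + y) = \<beta> z x + \<beta> z y) \<and> (\<forall>c x z. \<beta> z (scale c x) = scale c (\<beta> z x))"
proof -
  interpret vector_space scale by fact
  have "Vector_Spaces.linear scale scale f \<longleftrightarrow> (\<forall>x y. f (x + y) = f x + f y) \<and> (\<forall>c x. f (scale c x) = scale c (f x))" for f
    by (simp add: Vector_Spaces.linear_def module_hom_iff vector_space_axioms module_axioms)
  then show ?thesis unfolding bilinear_map_def by (simp only: all_conj_distrib) blast
qed

text \<open>
  The bracket of representatives.  The choice of representatives does not matter for bilinear
  \<open>\<beta>\<close>, because the free bracket then preserves the ideal in both arguments.
\<close>

definition sym_bracket :: "('k::field \<Rightarrow> 'q::ab_group_add \<Rightarrow> 'q) \<Rightarrow> ('q \<Rightarrow> 'q \<Rightarrow> 'q) \<Rightarrow>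
    ('k, 'q) free_alg set \<Rightarrow> ('k, 'q) free_alg set \<Rightarrow> ('k, 'q) free_alg set" where
  "sym_bracket scale \<beta> = (\<lambda>s\<in>carrier (sym_algebra scale). \<lambda>t\<in>carrier (sym_algebra scale).
     sym_class scale (free_bracket \<beta> (SOME f. sym_class scale f = s) (SOME g. sym_class scale g = t)))"

context vector_space
begin

lemma free_deriv_in_sym_ideal:
  assumes "\<And>v. \<delta> v \<in> sym_ideal scale"
  shows "free_deriv \<delta> f \<in> sym_ideal scale"
  unfolding free_deriv_def monomial_deriv_def
  by (intro sym_ideal_sum sym_ideal_mult assms)

text \<open>
  The elements of the ideal whose image lies in the ideal form an ideal themselves by the Leibniz
  rule; the two hypotheses say that it contains the generators.
\<close>

lemma free_deriv_sym_ideal: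
  assumes gens: "\<And>v w. \<delta> (v + w) - \<delta> v - \<delta> w \<in> sym_ideal scale"
      "\<And>c v. \<delta> (scale c v) - free_const c * \<delta> v \<in> sym_ideal scale"
    and "f \<in> sym_ideal scale"
  shows "free_deriv \<delta> f \<in> sym_ideal scale"
proof -
  have "sym_ideal scale \<subseteq> {f \<in> sym_ideal scale. free_deriv \<delta> f \<in> sym_ideal scale}"
    by (rule sym_ideal_subset)
       (auto simp: free_deriv_add free_deriv_diff free_deriv_mult gens sym_ideal_var_add sym_ideal_var_scale
         intro!: sym_ideal_add intro: sym_ideal_mult sym_ideal_mult_right)
  then show ?thesis using assms(3) by auto
qed

lemma free_bracket_sym_ideal_left:
  assumes \<beta>: "bilinear_map scale \<beta>" and f: "f \<in> sym_ideal scale"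
  shows "free_bracket \<beta> f g \<in> sym_ideal scale"
  unfolding free_bracket_def
proof (rule free_deriv_sym_ideal[OF _ _ f])
  note \<beta> = \<beta>[unfolded bilinear_map_iff[OF vector_space_axioms]]
  show "free_deriv (\<lambda>u. free_var (\<beta> (v + w) u)) g - free_deriv (\<lambda>u. free_var (\<beta> v u)) g
      - free_deriv (\<lambda>u. free_var (\<beta> w u)) g \<in> sym_ideal scale" for v w
    by (simp add: \<beta> sym_ideal_var_add free_deriv_in_sym_ideal flip: free_deriv_rule_diff)
  show "free_deriv (\<lambda>u. free_var (\<beta> (scale c v) u)) g
      - free_const c * free_deriv (\<lambda>u. free_var (\<beta> v u)) g \<in> sym_ideal scale" for c v
    by (simp add: \<beta> sym_ideal_var_scale free_deriv_in_sym_ideal flip: free_deriv_rule_diff free_deriv_rule_mult)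
qed

lemma free_bracket_sym_ideal_right:
  assumes \<beta>: "bilinear_map scale \<beta>" and g: "g \<in> sym_ideal scale"
  shows "free_bracket \<beta> f g \<in> sym_ideal scale"
  unfolding free_bracket_def
proof (rule free_deriv_in_sym_ideal, rule free_deriv_sym_ideal[OF _ _ g])
  note \<beta> = \<beta>[unfolded bilinear_map_iff[OF vector_space_axioms]]
  fix u
  show "free_var (\<beta> u (v + w)) - free_var (\<beta> u v) - free_var (\<beta> u w) \<in> sym_ideal scale" for v w
    by (simp add: \<beta> sym_ideal_var_add)
  show "free_var (\<beta> u (scale c v)) - free_const c * free_var (\<beta> u v) \<in> sym_ideal scale" for c v
    by (simp add: \<beta> sym_ideal_var_scale)
qed

text \<open>
  The principle that derivations are determined by their values on generators, in the form needed for
  skew symmetry and the Jacobi identity modulo the ideal.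
\<close>

lemma derivation_in_sym_idealI:
  assumes const: "\<And>c. D (free_const c) \<in> sym_ideal scale"
    and add: "\<And>f g. D (f + g) = D f + D g"
    and mult: "\<And>f g. D (f * g) = f * D g + g * D f"
    and var: "\<And>v. D (free_var v) \<in> sym_ideal scale"
  shows "D f \<in> sym_ideal scale"
  by (induction f rule: free_alg_induct)
     (auto simp: const add mult var intro!: sym_ideal_add intro: sym_ideal_mult sym_ideal_mult_right)

lemma sym_bracket_class:
  assumes \<beta>: "bilinear_map scale \<beta>"
  shows "sym_bracket scale \<beta> (sym_class scale f) (sym_class scale g) = sym_class scale (free_bracket \<beta> f g)"
proof -
  define f' g' where "f' = (SOME u. sym_class scale u = sym_class scale f)"
    and "g' = (SOME u. sym_class scale u = sym_class scale g)"
  have "sym_class scale f' = sym_class scale f" "sym_class scale g' = sym_class scale g"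
    unfolding f'_def g'_def by (rule someI_ex, blast)+
  then have "f' - f \<in> sym_ideal scale" "g' - g \<in> sym_ideal scale"
    by (simp_all add: sym_class_eq_iff)
  then have "free_bracket \<beta> (f' - f) g' + free_bracket \<beta> f (g' - g) \<in> sym_ideal scale"
    by (intro sym_ideal_add free_bracket_sym_ideal_left free_bracket_sym_ideal_right \<beta>)
  then have "sym_class scale (free_bracket \<beta> f' g') = sym_class scale (free_bracket \<beta> f g)"
    by (simp add: sym_class_eq_iff free_bracket_diff_left free_bracket_diff_right)
  then show ?thesis by (simp add: sym_bracket_def f'_def g'_def)
qed

lemma sym_bracket_emb:
  assumes \<beta>: "bilinear_map scale \<beta>"
  shows "sym_bracket scale \<beta> (sym_emb scale v) (sym_emb scale w) = sym_emb scale (\<beta> v w)"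
  by (simp add: sym_emb_def sym_bracket_class[OF \<beta>] free_bracket_var_left)

lemma biderivation_sym_bracket:
  assumes \<beta>: "bilinear_map scale \<beta>"
  shows "biderivation (sym_algebra scale) (sym_bracket scale \<beta>)"
  unfolding biderivation_def
proof (intro conjI ballI allI)
  show "sym_bracket scale \<beta> \<in> carrier (sym_algebra scale) \<rightarrow>\<^sub>E (carrier (sym_algebra scale) \<rightarrow>\<^sub>E carrier (sym_algebra scale))"
    unfolding sym_bracket_def by (intro restrict_PiE_iff[THEN iffD2] ballI) auto
qed (auto simp: carrier_sym_algebra sym_bracket_class[OF \<beta>] free_bracket_add_left free_bracket_add_right
    free_bracket_mult_left free_bracket_mult_right mult.commute)

text \<open>
  Existence is \<open>biderivation_sym_bracket\<close>; uniqueness holds because a biderivation is a derivation in each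
  argument and the vectors generate the symmetric algebra.
\<close>

lemma leibniz_extension_eq:
  assumes \<beta>: "bilinear_map scale \<beta>"
  shows "leibniz_extension scale \<beta> = sym_bracket scale \<beta>"
  unfolding leibniz_extension_def
proof (rule the_equality)
  show "biderivation (sym_algebra scale) (sym_bracket scale \<beta>) \<and>
     (\<forall>x y. sym_bracket scale \<beta> (sym_emb scale x) (sym_emb scale y) = sym_emb scale (\<beta> x y))"
    using biderivation_sym_bracket[OF \<beta>] sym_bracket_emb[OF \<beta>] by blast
  show "P = sym_bracket scale \<beta>" if "biderivation (sym_algebra scale) P \<and>
     (\<forall>x y. P (sym_emb scale x) (sym_emb scale y) = sym_emb scale (\<beta> x y))" for P
    using that biderivation_eqI[of scale P "sym_bracket scale \<beta>"] biderivation_sym_bracket[OF \<beta>] sym_bracket_emb[OF \<beta>]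
    by metis
qed

lemma bilinear_map_comb:
  assumes "bilinear_map scale \<beta>" "bilinear_map scale \<gamma>"
  shows "bilinear_map scale (\<lambda>x y. scale a (\<beta> x y) + scale b (\<gamma> x y))"
  using assms unfolding bilinear_map_iff[OF vector_space_axioms]
  by (simp add: scale_right_distrib add_ac mult.commute)

text \<open>
  On variables \<open>X\<^sub>v\<close>, \<open>X\<^sub>w\<close> the two sides differ by a combination of generators of the ideal;
  linearity of \<^term>\<open>free_deriv \<delta> f\<close> in \<open>\<delta>\<close> carries this over to all polynomials.
\<close>

lemma bracket_comb_sym_bracket:
  assumes \<beta>: "bilinear_map scale \<beta>" and \<gamma>: "bilinear_map scale \<gamma>"
  shows "bracket_comb (sym_algebra scale) a (sym_bracket scale \<beta>) b (sym_bracket scale \<gamma>)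
    = sym_bracket scale (\<lambda>x y. scale a (\<beta> x y) + scale b (\<gamma> x y))" (is "_ = sym_bracket scale ?\<alpha>")
proof -
  have \<alpha>: "bilinear_map scale ?\<alpha>" using \<beta> \<gamma> by (rule bilinear_map_comb)
  have "free_bracket ?\<alpha> f g - (free_const a * free_bracket \<beta> f g + free_const b * free_bracket \<gamma> f g) \<in> sym_ideal scale" for f g
  proof -
    have "free_var (?\<alpha> v w) - (free_const a * free_var (\<beta> v w) + free_const b * free_var (\<gamma> v w)) \<in> sym_ideal scale" for v w
      using sym_ideal_add[OF sym_ideal_add[OF sym_ideal_var_add[of "scale a (\<beta> v w)" "scale b (\<gamma> v w)"]
            sym_ideal_var_scale[of scale a "\<beta> v w"]] sym_ideal_var_scale[of scale b "\<gamma> v w"]]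
      by (simp add: algebra_simps)
    then have "free_deriv (\<lambda>v. free_deriv (\<lambda>w. free_var (?\<alpha> v w)
        - (free_const a * free_var (\<beta> v w) + free_const b * free_var (\<gamma> v w))) g) f \<in> sym_ideal scale"
      by (intro free_deriv_in_sym_ideal)
    then show ?thesis
      by (simp add: free_bracket_def free_deriv_rule_diff free_deriv_rule_add free_deriv_rule_mult)
  qed
  then have *: "sym_class scale (free_bracket ?\<alpha> f g)
      = sym_class scale (free_const a * free_bracket \<beta> f g + free_const b * free_bracket \<gamma> f g)" for f g
    by (simp add: sym_class_eq_iff)
  show ?thesis
  proof (rule bracket_extensionalI[where scale = scale])
    show "bracket_comb (sym_algebra scale) a (sym_bracket scale \<beta>) b (sym_bracket scale \<gamma>)
      \<in> carrier (sym_algebra scale) \<rightarrow>\<^sub>E (carrier (sym_algebra scale) \<rightarrow>\<^sub>E carrier (sym_algebra scale))"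
      unfolding bracket_comb_def
      by (intro restrict_PiE_iff[THEN iffD2] ballI)
         (auto simp: carrier_sym_algebra sym_bracket_class[OF \<beta>] sym_bracket_class[OF \<gamma>])
    show "sym_bracket scale ?\<alpha> \<in> carrier (sym_algebra scale) \<rightarrow>\<^sub>E (carrier (sym_algebra scale) \<rightarrow>\<^sub>E carrier (sym_algebra scale))"
      using biderivation_sym_bracket[OF \<alpha>] by (simp add: biderivation_def)
  qed (simp add: bracket_comb_def * sym_bracket_class[OF \<alpha>] sym_bracket_class[OF \<beta>] sym_bracket_class[OF \<gamma>])
qed

end

section \<open>From Lie brackets to Poisson brackets\<close>

definition free_jacobiator :: "('q \<Rightarrow> 'q \<Rightarrow> 'q) \<Rightarrow> ('k::comm_ring_1, 'q) free_alg \<Rightarrow>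
    ('k, 'q) free_alg \<Rightarrow> ('k, 'q) free_alg \<Rightarrow> ('k, 'q) free_alg" where
  "free_jacobiator \<beta> f g h = free_bracket \<beta> f (free_bracket \<beta> g h) + free_bracket \<beta> g (free_bracket \<beta> h f)
     + free_bracket \<beta> h (free_bracket \<beta> f g)"

lemma free_jacobiator_rotate: "free_jacobiator \<beta> g h f = free_jacobiator \<beta> f g h"
  by (simp add: free_jacobiator_def algebra_simps)

context lie_algebra
begin

text \<open>
  Already for two variables the sum is \<open>X\<^bsub>[v,w]\<^esub> + X\<^bsub>[w,v]\<^esub>\<close>, which need not be zero but lies in the ideal.
  As the expression is a derivation in each argument, the variables suffice.
\<close>

lemma free_bracket_skew: "free_bracket br f g + free_bracket br g f \<in> sym_ideal scale"
proof -
  note br = bilinear[unfolded bilinear_map_iff[OF vector_space_axioms]]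
  have skew: "br v w + br w v = 0" for v w
  proof -
    have "br (v + w) (v + w) = br v v + br w v + (br v w + br w w)"
      by (simp only: br add_ac)
    then show ?thesis by (simp add: alternating add.commute)
  qed
  have zero: "free_var 0 \<in> sym_ideal scale"
    using sym_ideal_uminus[OF sym_ideal_var_add[of 0 0 scale]] by simp
  have var: "free_bracket br f (free_var w) + free_bracket br (free_var w) f \<in> sym_ideal scale" for f w
  proof (rule derivation_in_sym_idealI[where D = "\<lambda>f. free_bracket br f (free_var w) + free_bracket br (free_var w) f"])
    show "free_bracket br (free_var v) (free_var w) + free_bracket br (free_var w) (free_var v) \<in> sym_ideal scale" for v
      using sym_ideal_diff[OF zero sym_ideal_var_add[of "br v w" "br w v" scale]]
      by (simp add: free_bracket_var_left skew)
  qed (simp_all add: free_bracket_add_left free_bracket_add_right free_bracket_mult_left free_bracket_mult_right algebra_simps)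
  show ?thesis
    by (rule derivation_in_sym_idealI[where D = "\<lambda>g. free_bracket br f g + free_bracket br g f"])
       (use var in \<open>simp_all add: free_bracket_add_left free_bracket_add_right free_bracket_mult_left free_bracket_mult_right algebra_simps\<close>)
qed

text \<open>
  Up to skew symmetry the Jacobiator is \<open>(ad f \<circ> ad g - ad g \<circ> ad f - ad {f, g}) h\<close>: a commutator of
  derivations minus a derivation, hence a derivation in \<open>h\<close>.
\<close>

lemma free_jacobiator_in_sym_idealI:
  assumes "\<And>w. free_jacobiator br f g (free_var w) \<in> sym_ideal scale"
  shows "free_jacobiator br f g h \<in> sym_ideal scale"
proof -
  define K where "K h = free_bracket br f (free_bracket br g h) - free_bracket br g (free_bracket br f h)
    - free_bracket br (free_bracket br f g) h" for h
  have J: "free_jacobiator br f g h - K h \<in> sym_ideal scale" for h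
  proof -
    have "free_jacobiator br f g h - K h = free_bracket br g (free_bracket br f h + free_bracket br h f)
        + (free_bracket br h (free_bracket br f g) + free_bracket br (free_bracket br f g) h)"
      by (simp add: free_jacobiator_def K_def free_bracket_add_right algebra_simps)
    then show ?thesis
      using sym_ideal_add free_bracket_sym_ideal_right[OF bilinear free_bracket_skew] free_bracket_skew by metis
  qed
  have "K h \<in> sym_ideal scale"
  proof (rule derivation_in_sym_idealI[where D = K])
    show "K (free_var w) \<in> sym_ideal scale" for w
      using sym_ideal_diff[OF assms[of w] J[of "free_var w"]] by simp
  qed (simp_all add: K_def free_bracket_add_left free_bracket_add_right free_bracket_mult_right algebra_simps)
  then show ?thesis using sym_ideal_add[OF J[of h], of "K h"] by simp
qed

text \<open>
  Cyclic symmetry moves each of the three arguments in turn to the last place, where it may be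
  assumed to be a variable.  For three variables the claim is the Jacobi identity of the Lie algebra.
\<close>

lemma free_jacobiator_in_sym_ideal: "free_jacobiator br f g h \<in> sym_ideal scale"
proof -
  have vars: "free_jacobiator br (free_var u) (free_var v) (free_var w) \<in> sym_ideal scale" for u v w
  proof -
    define a b c where "a = br u (br v w)" and "b = br v (br w u)" and "c = br w (br u v)"
    have zero: "free_var 0 \<in> sym_ideal scale"
      using sym_ideal_uminus[OF sym_ideal_var_add[of 0 0 scale]] by simp
    have "a + b + c = 0" using jacobi by (simp add: a_def b_def c_def)
    then have "free_var a + free_var b + free_var c = free_var 0
        - (free_var (a + b) - free_var a - free_var b) - (free_var (a + b + c) - free_var (a + b) - free_var c)"
      by simp
    then have "free_var a + free_var b + free_var c \<in> sym_ideal scale"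
      using sym_ideal_diff[OF sym_ideal_diff[OF zero sym_ideal_var_add] sym_ideal_var_add] by metis
    then show ?thesis by (simp add: free_jacobiator_def free_bracket_var_left a_def b_def c_def)
  qed
  have two_vars: "free_jacobiator br (free_var u) (free_var v) h \<in> sym_ideal scale" for u v h
    using vars by (rule free_jacobiator_in_sym_idealI)
  have one_var: "free_jacobiator br (free_var v) g h \<in> sym_ideal scale" for v g h
  proof (rule free_jacobiator_in_sym_idealI)
    show "free_jacobiator br (free_var v) g (free_var w) \<in> sym_ideal scale" for w
      using two_vars[of w v g] free_jacobiator_rotate[where g = "free_var v" and h = g and f = "free_var w"] by simp
  qed
  show ?thesis
  proof (rule free_jacobiator_in_sym_idealI)
    show "free_jacobiator br f g (free_var w) \<in> sym_ideal scale" for w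
      using one_var[of w f g] free_jacobiator_rotate[where g = f and h = g and f = "free_var w"] by simp
  qed
qed

end

text \<open>
  Skew symmetry gives \<open>2 {f, f} = 0\<close>, and \<open>2\<close> is invertible in characteristic \<open>0\<close>.
\<close>

lemma lie_algebra_poisson_bracket:
  fixes scale :: "'k::field_char_0 \<Rightarrow> 'q::ab_group_add \<Rightarrow> 'q"
  assumes "lie_algebra scale br"
  shows "poisson_bracket (sym_algebra scale) (leibniz_extension scale br)"
proof -
  interpret lie_algebra scale br by fact
  have "free_bracket br f f \<in> sym_ideal scale" for f
  proof -
    have "(free_const (1 / 2) + free_const (1 / 2)) * free_bracket br f f = free_bracket br f f"
      by (simp flip: free_const_add)
    then show ?thesis
      using sym_ideal_mult[OF free_bracket_skew[of f f], of "free_const (1 / 2)"] by (simp add: algebra_simps)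
  qed
  then show ?thesis
    using free_jacobiator_in_sym_ideal biderivation_sym_bracket[OF bilinear]
    by (auto simp: poisson_bracket_def leibniz_extension_eq[OF bilinear] carrier_sym_algebra
        sym_bracket_class[OF bilinear] sym_class_eq_zero_iff free_jacobiator_def)
qed

section \<open>Eigenspaces of an automorphism of finite order\<close>

locale periodic_lie_algebra = lie_algebra scale br
  for scale :: "'k::field_char_0 \<Rightarrow> 'q::ab_group_add \<Rightarrow> 'q" and br +
  fixes \<theta> :: "'q \<Rightarrow> 'q" and m :: nat and \<zeta> :: 'k
  assumes automorphism: "lie_automorphism scale br \<theta>"
    and periodic: "\<theta> ^^ m = id"
    and primitive: "primitive_root_of_unity m \<zeta>"
begin

lemma br_simps:
  "br (x + y) z = br x z + br y z" "br z (x + y) = br z x + br z y"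
  "br (scale c x) z = scale c (br x z)" "br z (scale c x) = scale c (br z x)"
  "br 0 z = 0" "br z 0 = 0"
proof -
  note * = bilinear[unfolded bilinear_map_iff[OF vector_space_axioms]]
  show "br (x + y) z = br x z + br y z" "br z (x + y) = br z x + br z y"
    "br (scale c x) z = scale c (br x z)" "br z (scale c x) = scale c (br z x)"
    using * by blast+
  show "br 0 z = 0" "br z 0 = 0"
    using *[THEN conjunct2, THEN conjunct1, rule_format, of 0 0 z]
      *[THEN conjunct2, THEN conjunct2, THEN conjunct2, rule_format, of z 0 0] by simp_all
qed

lemma \<theta>_add: "\<theta> (x + y) = \<theta> x + \<theta> y" and \<theta>_scale: "\<theta> (scale c x) = scale c (\<theta> x)"
  and \<theta>_br: "\<theta> (br x y) = br (\<theta> x) (\<theta> y)"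
  using automorphism by (simp_all add: lie_automorphism_def Vector_Spaces.linear_def module_hom_iff)

lemma \<theta>_0: "\<theta> 0 = 0"
  using \<theta>_scale[of 0 0] by simp

lemma \<theta>_sum: "\<theta> (sum h X) = (\<Sum>x\<in>X. \<theta> (h x))"
  by (induction X rule: infinite_finite_induct) (simp_all add: \<theta>_add \<theta>_0)

lemma funpow_\<theta>_add: "(\<theta> ^^ n) (x + y) = (\<theta> ^^ n) x + (\<theta> ^^ n) y"
  and funpow_\<theta>_scale: "(\<theta> ^^ n) (scale c x) = scale c ((\<theta> ^^ n) x)"
  by (induction n) (simp_all add: \<theta>_add \<theta>_scale)

lemma m_pos: "0 < m" and \<zeta>_power_m: "\<zeta> ^ m = 1" and \<zeta>_nonzero: "\<zeta> \<noteq> 0"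
  using primitive by (auto simp: primitive_root_of_unity_def power_0_left)

lemma \<zeta>_power_mod: "\<zeta> ^ (n mod m) = \<zeta> ^ n"
proof -
  have "\<zeta> ^ n = \<zeta> ^ (m * (n div m) + n mod m)" by simp
  then show ?thesis by (simp only: power_add power_mult \<zeta>_power_m) simp
qed

lemma \<zeta>_power_inj: "i < m \<Longrightarrow> j < m \<Longrightarrow> \<zeta> ^ i = \<zeta> ^ j \<Longrightarrow> i = j"
proof (induction i j rule: linorder_wlog)
  case (le i j)
  have "\<zeta> ^ i * \<zeta> ^ (j - i) = \<zeta> ^ j"
    using \<open>i \<le> j\<close> by (simp flip: power_add)
  also have "\<dots> = \<zeta> ^ i * 1"
    using le.prems by simp
  finally have "\<zeta> ^ i * \<zeta> ^ (j - i) = \<zeta> ^ i * 1" .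
  then have "\<zeta> ^ (j - i) = 1"
    using \<zeta>_nonzero by simp
  then show ?case
    using primitive le unfolding primitive_root_of_unity_def by (metis diff_is_0_eq le_antisym less_imp_diff_less not_gr_zero)
qed auto

lemma root_of_unity_sum: "r ^ m = 1 \<Longrightarrow> r \<noteq> 1 \<Longrightarrow> (\<Sum>k<m. r ^ k) = 0" for r :: 'k
  using one_diff_power_eq[of r m] by simp

text \<open>
  The discrete Fourier transform of the orbit of \<open>x\<close> under \<open>\<theta>\<close>; it turns out to be the component of \<open>x\<close> in
  the eigenspace for \<open>\<zeta>\<^sup>j\<close>.
\<close>

definition projection :: "nat \<Rightarrow> 'q \<Rightarrow> 'q" where
  "projection j x = scale (1 / of_nat m) (\<Sum>k<m. scale (inverse (\<zeta> ^ j) ^ k) ((\<theta> ^^ k) x))"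

lemma projection_add: "projection j (x + y) = projection j x + projection j y"
  by (simp add: projection_def funpow_\<theta>_add scale_right_distrib sum.distrib)

lemma projection_scale: "projection j (scale c x) = scale c (projection j x)"
  by (simp add: projection_def funpow_\<theta>_scale scale_sum_right mult_ac)

text \<open>
  Applying \<open>\<theta>\<close> shifts the summation index by one, up to the factor \<open>\<zeta>\<^sup>j\<close>, and the summand is
  periodic in the index with period \<open>m\<close>.
\<close>

lemma projection_eigen: "projection j x \<in> eigencomponent scale \<theta> \<zeta> j"
proof -
  define c where "c = inverse (\<zeta> ^ j)"
  define h where "h k = scale (c ^ k) ((\<theta> ^^ k) x)" for k
  have c: "\<zeta> ^ j * c = 1" "c ^ m = 1"
    using \<zeta>_nonzero \<zeta>_power_m by (simp_all add: c_def power_inverse flip: power_mult)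
      (simp add: power_mult mult.commute[of j])
  have step: "\<theta> (h k) = scale (\<zeta> ^ j) (h (Suc k))" for k
    using c by (simp add: h_def \<theta>_scale flip: mult.assoc)
  have "h m = h 0"
    using c by (simp add: h_def periodic)
  then have shift: "(\<Sum>k<m. h (Suc k)) = (\<Sum>k<m. h k)"
    using sum.lessThan_Suc_shift[of h m] by simp
  have "\<theta> (\<Sum>k<m. h k) = scale (\<zeta> ^ j) (\<Sum>k<m. h k)"
    by (simp add: \<theta>_sum step shift flip: scale_sum_right)
  then show ?thesis
    by (simp add: eigencomponent_def projection_def \<theta>_scale mult.commute flip: h_def c_def)
qed

text \<open>
  Orthogonality of characters: summing over \<open>j\<close> leaves only the term \<open>\<theta>\<^sup>0 x\<close>, which occurs \<open>m\<close> times.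
\<close>

lemma sum_projection: "(\<Sum>j<m. projection j x) = x"
proof -
  have root: "(\<Sum>j<m. inverse (\<zeta> ^ j) ^ k) = (if k = 0 then of_nat m else 0)" if "k < m" for k
  proof (cases "k = 0")
    case False
    have "inverse (\<zeta> ^ k) ^ m = 1"
      by (simp add: power_inverse flip: power_mult) (simp add: power_mult mult.commute[of k] \<zeta>_power_m)
    moreover have "inverse (\<zeta> ^ k) \<noteq> 1"
      using \<zeta>_power_inj[of k 0] that m_pos False by auto
    ultimately have "(\<Sum>j<m. inverse (\<zeta> ^ k) ^ j) = 0" by (rule root_of_unity_sum)
    moreover have "inverse (\<zeta> ^ k) ^ j = inverse (\<zeta> ^ j) ^ k" for j
      by (simp add: power_inverse mult.commute flip: power_mult)
    ultimately show ?thesis using False by simp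
  qed simp
  have "(\<Sum>j<m. projection j x)
      = scale (1 / of_nat m) (\<Sum>k<m. \<Sum>j<m. scale (inverse (\<zeta> ^ j) ^ k) ((\<theta> ^^ k) x))"
    unfolding projection_def scale_sum_right[symmetric] by (subst sum.swap) (rule refl)
  also have "(\<Sum>k<m. \<Sum>j<m. scale (inverse (\<zeta> ^ j) ^ k) ((\<theta> ^^ k) x))
      = (\<Sum>k<m. if k = 0 then scale (of_nat m) x else 0)"
    by (rule sum.cong[OF refl]) (simp add: root flip: scale_sum_left)
  also have "\<dots> = scale (of_nat m) x"
    using m_pos by simp
  finally show ?thesis using m_pos by simp
qed

lemma projection_eigenvector:
  assumes "i < m" "j < m" and x: "x \<in> eigencomponent scale \<theta> \<zeta> i"
  shows "projection j x = (if j = i then x else 0)"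
proof -
  define r where "r = inverse (\<zeta> ^ j) * \<zeta> ^ i"
  have pow: "(\<theta> ^^ k) x = scale ((\<zeta> ^ i) ^ k) x" for k
    using x by (induction k) (simp_all add: eigencomponent_def \<theta>_scale mult.commute)
  have "projection j x = scale (1 / of_nat m * (\<Sum>k<m. r ^ k)) x"
    by (simp add: projection_def pow r_def power_mult_distrib flip: scale_sum_left)
  moreover have "(\<Sum>k<m. r ^ k) = (if j = i then of_nat m else 0)"
  proof (cases "j = i")
    case False
    have "r ^ m = (inverse (\<zeta> ^ m)) ^ j * (\<zeta> ^ m) ^ i"
      by (simp add: r_def power_mult_distrib power_inverse mult.commute flip: power_mult)
    then have "r ^ m = 1" by (simp add: \<zeta>_power_m)
    moreover have "r \<noteq> 1"
      using \<zeta>_power_inj[of i j] assms False \<zeta>_nonzero by (auto simp: r_def field_simps)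
    ultimately show ?thesis using False root_of_unity_sum by simp
  qed (use \<zeta>_nonzero in \<open>simp add: r_def\<close>)
  ultimately show ?thesis using m_pos by simp
qed

text \<open>
  Every vector is a sum of eigenvectors, so an additive map can be tested on eigenvectors.  Applied to one
  argument at a time, this reduces all multilinear identities below to homogeneous elements.
\<close>

lemma additive_zeroI:
  fixes f :: "'q \<Rightarrow> 'r::ab_group_add"
  assumes add: "\<And>x y. f (x + y) = f x + f y"
    and eigen: "\<And>i x. i < m \<Longrightarrow> x \<in> eigencomponent scale \<theta> \<zeta> i \<Longrightarrow> f x = 0"
  shows "f x = 0"
proof -
  have "f 0 = 0" using add[of 0 0] by simp
  then have sum: "f (sum h X) = (\<Sum>x\<in>X. f (h x))" for h :: "nat \<Rightarrow> 'q" and X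
    by (induction X rule: infinite_finite_induct) (simp_all add: add)
  have "f (\<Sum>j<m. projection j x) = 0"
    unfolding sum by (rule sum.neutral) (use eigen projection_eigen in blast)
  then show ?thesis by (simp add: sum_projection)
qed

section \<open>The pencil of Lie brackets\<close>

definition graded_bracket :: "'k \<Rightarrow> 'k \<Rightarrow> 'q \<Rightarrow> 'q \<Rightarrow> 'q" where
  "graded_bracket a b x y =
     (\<Sum>i<m. \<Sum>j<m. scale (if i + j < m then a else b) (br (projection i x) (projection j y)))"

lemma bilinear_graded_bracket: "bilinear_map scale (graded_bracket a b)"
  unfolding bilinear_map_iff[OF vector_space_axioms] graded_bracket_def
  by (simp add: projection_add projection_scale br_simps scale_right_distrib sum.distrib scale_sum_right mult.commute)

lemma graded_bracket_eigen:
  assumes "i < m" "j < m" "x \<in> eigencomponent scale \<theta> \<zeta> i" "y \<in> eigencomponent scale \<theta> \<zeta> j"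
  shows "graded_bracket a b x y = scale (if i + j < m then a else b) (br x y)"
proof -
  have "graded_bracket a b x y = (\<Sum>i'<m. \<Sum>j'<m.
      if i' = i \<and> j' = j then scale (if i + j < m then a else b) (br x y) else 0)"
    unfolding graded_bracket_def
    by (intro sum.cong refl) (use assms in \<open>auto simp: projection_eigenvector br_simps\<close>)
  also have "\<dots> = (\<Sum>i'<m. if i' = i then scale (if i + j < m then a else b) (br x y) else 0)"
    using assms by (intro sum.cong refl) (auto simp: sum.delta)
  finally show ?thesis using assms by simp
qed

text \<open>
  This gives the two brackets of the pencil, the initial bracket and all linear combinations
  the common form \<^term>\<open>graded_bracket a b\<close>.
\<close>

lemma graded_bracket_unique:
  assumes \<beta>: "bilinear_map scale \<beta>"
    and eigen: "\<And>i j x y. i < m \<Longrightarrow> j < m \<Longrightarrow> x \<in> eigencomponent scale \<theta> \<zeta> i \<Longrightarrow> y \<in> eigencomponent scale \<theta> \<zeta> j \<Longrightarrow>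
        \<beta> x y = scale (if i + j < m then a else b) (br x y)"
  shows "\<beta> = graded_bracket a b"
proof (intro ext)
  fix x y
  note bl = \<beta>[unfolded bilinear_map_iff[OF vector_space_axioms]]
    bilinear_graded_bracket[of a b, unfolded bilinear_map_iff[OF vector_space_axioms]]
  have left: "\<beta> x y - graded_bracket a b x y = 0" if "i < m" "x \<in> eigencomponent scale \<theta> \<zeta> i" for i x
    by (rule additive_zeroI[where f = "\<lambda>y. \<beta> x y - graded_bracket a b x y"])
       (use that bl eigen graded_bracket_eigen in \<open>auto simp: algebra_simps\<close>)
  have "\<beta> x y - graded_bracket a b x y = 0"
    by (rule additive_zeroI[where f = "\<lambda>x. \<beta> x y - graded_bracket a b x y"]) (use left bl in \<open>auto simp: algebra_simps\<close>)
  then show "\<beta> x y = graded_bracket a b x y" by simp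
qed

lemma bracket_zero_eq: "bracket_zero scale br \<theta> m \<zeta> = graded_bracket 1 0"
  unfolding bracket_zero_def
  by (rule the_equality)
     (auto simp: bilinear_graded_bracket graded_bracket_eigen intro!: graded_bracket_unique)

lemma bracket_infinity_eq: "bracket_infinity scale br \<theta> m \<zeta> = graded_bracket 0 1"
  unfolding bracket_infinity_def
  by (rule the_equality)
     (auto simp: bilinear_graded_bracket graded_bracket_eigen intro!: graded_bracket_unique)

lemma br_eq_graded_bracket: "br = graded_bracket 1 1"
  by (rule graded_bracket_unique) (simp_all add: bilinear)

lemma graded_bracket_comb:
  "(\<lambda>x y. scale a (graded_bracket 1 0 x y) + scale b (graded_bracket 0 1 x y)) = graded_bracket a b"
  by (rule graded_bracket_unique)
     (auto simp: graded_bracket_eigen intro!: bilinear_map_comb bilinear_graded_bracket)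

lemma eigencomponent_br:
  assumes "x \<in> eigencomponent scale \<theta> \<zeta> i" "y \<in> eigencomponent scale \<theta> \<zeta> j"
  shows "br x y \<in> eigencomponent scale \<theta> \<zeta> ((i + j) mod m)"
  using assms by (simp add: eigencomponent_def \<theta>_br br_simps \<zeta>_power_mod power_add mult.commute)

lemma eigencomponent_scale:
  "x \<in> eigencomponent scale \<theta> \<zeta> i \<Longrightarrow> scale c x \<in> eigencomponent scale \<theta> \<zeta> i"
  by (simp add: eigencomponent_def \<theta>_scale mult.commute)

text \<open>
  The heart of the matter.  A factor \<open>b\<close> appears for each carry: one if \<open>j + k \<ge> m\<close>, and one if adding \<open>i\<close>
  to the residue of \<open>j + k\<close> reaches \<open>m\<close>.  Together these are \<open>(i + j + k) div m\<close> carries, a number in which the order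
  of \<open>i, j, k\<close> and the bracketing have disappeared.
\<close>

lemma graded_bracket_nested:
  assumes "i < m" "j < m" "k < m"
    and x: "x \<in> eigencomponent scale \<theta> \<zeta> i" and y: "y \<in> eigencomponent scale \<theta> \<zeta> j" and z: "z \<in> eigencomponent scale \<theta> \<zeta> k"
  shows "graded_bracket a b x (graded_bracket a b y z)
    = scale (if i + j + k < m then a * a else if i + j + k < 2 * m then a * b else b * b) (br x (br y z))"
proof -
  define w where "w = (\<lambda>i j. if i + j < m then a else b)"
  have "graded_bracket a b x (graded_bracket a b y z) = scale (w i ((j + k) mod m)) (br x (scale (w j k) (br y z)))"
    unfolding graded_bracket_eigen[OF assms(2,3) y z] w_def
    by (rule graded_bracket_eigen[OF assms(1) _ x eigencomponent_scale[OF eigencomponent_br[OF y z]]]) (simp add: m_pos)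
  also have "\<dots> = scale (w i ((j + k) mod m) * w j k) (br x (br y z))"
    by (simp add: br_simps)
  also have "w i ((j + k) mod m) * w j k = (if i + j + k < m then a * a else if i + j + k < 2 * m then a * b else b * b)"
  proof (cases "j + k < m")
    case False
    then have "(j + k) mod m = j + k - m" using assms by (simp add: le_mod_geq)
    then show ?thesis using False assms by (auto simp: w_def)
  qed (use assms in \<open>auto simp: w_def add.assoc mult.commute\<close>)
  finally show ?thesis .
qed

text \<open>
  On eigenvectors skew symmetry and the Jacobi identity are those of the given bracket times a
  common scalar.
\<close>

lemma lie_algebra_graded_bracket: "lie_algebra scale (graded_bracket a b)"
proof (intro lie_algebra.intro lie_algebra_axioms.intro)
  let ?\<beta> = "graded_bracket a b"
  show "vector_space scale" by (rule vector_space_axioms)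
  show "bilinear_map scale ?\<beta>" by (rule bilinear_graded_bracket)
  have add: "?\<beta> (x + y) z = ?\<beta> x z + ?\<beta> y z" "?\<beta> z (x + y) = ?\<beta> z x + ?\<beta> z y" for x y z
    using bilinear_graded_bracket[of a b, unfolded bilinear_map_iff[OF vector_space_axioms]] by blast+
  have br_skew: "br x y + br y x = 0" for x y
    using alternating[of "x + y"] alternating[of x] alternating[of y] by (simp only: br_simps) (simp add: add.commute)
  have skew_left: "?\<beta> x y + ?\<beta> y x = 0" if "i < m" "x \<in> eigencomponent scale \<theta> \<zeta> i" for i x y
    by (rule additive_zeroI[where f = "\<lambda>y. ?\<beta> x y + ?\<beta> y x"])
       (use that in \<open>auto simp: add graded_bracket_eigen add_ac br_skew simp flip: scale_right_distrib\<close>)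
  have skew: "?\<beta> x y + ?\<beta> y x = 0" for x y
    by (rule additive_zeroI[where f = "\<lambda>x. ?\<beta> x y + ?\<beta> y x"]) (use skew_left in \<open>auto simp: add add_ac\<close>)
  show "?\<beta> x x = 0" for x
  proof -
    have "scale 2 (?\<beta> x x) = 0" using skew[of x x] scale_left_distrib[of 1 1 "?\<beta> x x"] by simp
    then show ?thesis by simp
  qed
  let ?J = "\<lambda>x y z. ?\<beta> x (?\<beta> y z) + ?\<beta> y (?\<beta> z x) + ?\<beta> z (?\<beta> x y)"
  have J3: "?J x y z = 0" if x: "i < m" "x \<in> eigencomponent scale \<theta> \<zeta> i" and y: "j < m" "y \<in> eigencomponent scale \<theta> \<zeta> j"
    for i j x y z
  proof (rule additive_zeroI[where f = "\<lambda>z. ?J x y z"])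
    fix k z assume z: "k < m" "z \<in> eigencomponent scale \<theta> \<zeta> k"
    define c where "c = (if i + j + k < m then a * a else if i + j + k < 2 * m then a * b else b * b)"
    have "?\<beta> x (?\<beta> y z) = scale c (br x (br y z))" "?\<beta> y (?\<beta> z x) = scale c (br y (br z x))"
      "?\<beta> z (?\<beta> x y) = scale c (br z (br x y))"
      using graded_bracket_nested[OF x(1) y(1) z(1) x(2) y(2) z(2), of a b]
        graded_bracket_nested[OF y(1) z(1) x(1) y(2) z(2) x(2), of a b]
        graded_bracket_nested[OF z(1) x(1) y(1) z(2) x(2) y(2), of a b]
      by (simp_all add: c_def add_ac)
    then have "?J x y z = scale c (br x (br y z) + br y (br z x) + br z (br x y))"
      by (simp add: scale_right_distrib)
    then show "?J x y z = 0" by (simp add: jacobi)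
  qed (simp add: add add_ac)
  have J2: "?J x y z = 0" if x: "i < m" "x \<in> eigencomponent scale \<theta> \<zeta> i" for i x y z
  proof (rule additive_zeroI[where f = "\<lambda>y. ?J x y z"])
    show "?J x y z = 0" if "j < m" "y \<in> eigencomponent scale \<theta> \<zeta> j" for j y
      using J3[OF x that] .
  qed (simp add: add add_ac)
  show "?J x y z = 0" for x y z
  proof (rule additive_zeroI[where f = "\<lambda>x. ?J x y z"])
    show "?J x y z = 0" if "i < m" "x \<in> eigencomponent scale \<theta> \<zeta> i" for i x
      using J2[OF that] .
  qed (simp add: add add_ac)
qed

end

theorem corollary2p2:
  fixes scale :: "'k::{alg_closed_field, field_char_0} \<Rightarrow> 'q::ab_group_add \<Rightarrow> 'q"
    and br :: "'q \<Rightarrow> 'q \<Rightarrow> 'q"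
    and \<theta> :: "'q \<Rightarrow> 'q"
    and m :: nat
    and \<zeta> :: 'k
  assumes "algebraic_lie_algebra TYPE('g) scale br"
    and "finite_dimensional scale"
    and "lie_automorphism scale br \<theta>"
    and "m \<ge> 2"
    and "has_order \<theta> m"
    and "primitive_root_of_unity m \<zeta>"
  shows "let S = sym_algebra scale;
             P0 = leibniz_extension scale (bracket_zero scale br \<theta> m \<zeta>);
             Pinf = leibniz_extension scale (bracket_infinity scale br \<theta> m \<zeta>)
         in compatible S P0 Pinf \<and> leibniz_extension scale br \<in> pencil S P0 Pinf"
proof -
  interpret periodic_lie_algebra scale br \<theta> m \<zeta>
    using assms
    by (simp add: periodic_lie_algebra_def periodic_lie_algebra_axioms_def algebraic_lie_algebra_def has_order_def)
  have comb: "bracket_comb (sym_algebra scale) a (leibniz_extension scale (graded_bracket 1 0)) b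
      (leibniz_extension scale (graded_bracket 0 1)) = leibniz_extension scale (graded_bracket a b)" for a b
    by (simp add: leibniz_extension_eq bilinear_graded_bracket bracket_comb_sym_bracket graded_bracket_comb)
  have poisson: "poisson_bracket (sym_algebra scale) (leibniz_extension scale (graded_bracket a b))" for a b
    by (rule lie_algebra_poisson_bracket[OF lie_algebra_graded_bracket])
  have "leibniz_extension scale br = leibniz_extension scale (graded_bracket 1 1)"
    using br_eq_graded_bracket by simp
  then show ?thesis
    unfolding Let_def bracket_zero_eq bracket_infinity_eq compatible_def pencil_def comb
    using poisson by blast
qed

end
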